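(* Let $G \subset \mathrm{PU}(2,1)$ be a discrete subgroup acting on the complex hyperbolic space $\mathbb{H}^2_{\mathbb{C}}$. If the limit set $L(G) \subset \partial\mathbb{H}^2_{\mathbb{C}}$ is the image of a $C^2$ regular knot $\gamma:\mathbb{S}^1\to\partial\mathbb{H}^2_{\mathbb{C}}$, then $L(G)$ is the boundary of a totally geodesic subspace of $\mathbb{H}^2_{\mathbb{C}}$; in other words, $L(G)$ is either a chain or an $\mathbb{R}$-circle.
   Context: Equip $\mathbb{C}^3$ with the Hermitian form $\langle \mathbf{z},\mathbf{w}\rangle_1 = z_1\overline{w}_1+z_2\overline{w}_2-z_3\overline{w}_3$ and write $[\mathbf{z}]\in\mathbb{P}^2_{\mathbb{C}}$ for the class of $\mathbf{z}\neq\mathbf{0}$. The complex hyperbolic plane is $\mathbb{H}^2_{\mathbb{C}}=\{[\mathbf{z}]:\langle\mathbf{z},\mathbf{z}\rangle_1<0\}=\{[z_1:z_2:1]: |z_1|^2+|z_2|^2<1\}$ (with its standard complex hyperbolic metric induced by the form), and its boundary is the 3-sphere $\partial\mathbb{H}^2_{\mathbb{C}}=\{[\mathbf{z}]:\langle\mathbf{z},\mathbf{z}\rangle_1=0\}$. $\mathrm{PU}(2,1)\subset\mathrm{PGL}(3,\mathbb{C})$ is the projectivization of the unitary group of $\langle\cdot,\cdot\rangle_1$; it is the group of holomorphic isometries of $\mathbb{H}^2_{\mathbb{C}}$ and acts by diffeomorphisms on $\partial\mathbb{H}^2_{\mathbb{C}}$. The limit set $L(G)$ of a discrete subgroup $G\subset\mathrm{PU}(2,1)$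 is the set of cluster points (in $\mathbb{H}^2_{\mathbb{C}}\cup\partial\mathbb{H}^2_{\mathbb{C}}$) of the $G$-orbit of any point of $\mathbb{H}^2_{\mathbb{C}}$; it is independent of the point. A $C^k$ regular knot is an injective map $\mathbb{S}^1\to\partial\mathbb{H}^2_{\mathbb{C}}$ of class $C^k$ with nowhere vanishing derivative. A chain is the boundary at infinity of a complex geodesic (the nonempty intersection of a complex line with $\mathbb{H}^2_{\mathbb{C}}$), i.e. the circle $\ell\cap\partial\mathbb{H}^2_{\mathbb{C}}$ for a complex projective line $\ell\subset\mathbb{P}^2_{\mathbb{C}}$ meeting $\mathbb{H}^2_{\mathbb{C}}$. The canonical $\mathbb{R}$-circle is $R_0=\mathbb{P}^2_{\mathbb{R}}\cap\partial\mathbb{H}^2_{\mathbb{C}}$, where $\mathbb{P}^2_{\mathbb{R}}\subset\mathbb{P}^2_{\mathbb{C}}$ is the set of points having real homogeneous coordinates; an $\mathbb{R}$-circle is any image $h(R_0)$ with $h\in\mathrm{PU}(2,1)$. *)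

theory Defs
  imports "HOL-Analysis.Analysis" "HOL-Algebra.Coset"
begin

section \<open>The complex projective plane\<close>

text \<open>
  A point of the projective plane is the set of its homogeneous coordinate vectors, that is, a
  complex line through the origin of \<open>C^3\<close> with the origin removed.
\<close>

definition proj :: "complex^3 \<Rightarrow> (complex^3) set" where
  "proj z = {c *s z | c. c \<noteq> 0}"

definition quotient_topology :: "'a topology \<Rightarrow> ('a \<Rightarrow> 'b) \<Rightarrow> 'b topology" where
  "quotient_topology X q =
     topology (\<lambda>U. U \<subseteq> q ` topspace X \<and> openin X {x \<in> topspace X. q x \<in> U})"

definition P2C_topology :: "(complex^3) set topology" where
  "P2C_topology = quotient_topology (top_of_set (UNIV - {0})) proj"

definition projective_line :: "(complex^3) set set \<Rightarrow> bool" where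
  "projective_line l \<longleftrightarrow> (\<exists>W. vec.subspace W \<and> vec.dim W = 2 \<and> l = proj ` (W - {0}))"

definition P2R :: "(complex^3) set set" where
  "P2R = {proj z | z. z \<noteq> 0 \<and> (\<forall>i. z $ i \<in> \<real>)}"


section \<open>The complex hyperbolic plane and its boundary\<close>

definition herm :: "complex^3 \<Rightarrow> complex^3 \<Rightarrow> complex" where
  "herm z w = z$1 * cnj (w$1) + z$2 * cnj (w$2) - z$3 * cnj (w$3)"

definition HC2 :: "(complex^3) set set" where
  "HC2 = {proj z | z. z \<noteq> 0 \<and> Re (herm z z) < 0}"

definition bdHC2 :: "(complex^3) set set" where
  "bdHC2 = {proj z | z. z \<noteq> 0 \<and> herm z z = 0}"


section \<open>The groups \<open>PGL(3,C)\<close> and \<open>PU(2,1)\<close>\<close>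

definition GL3 :: "(complex^3^3) monoid" where
  "GL3 = \<lparr>carrier = {A. invertible A}, mult = (**), one = mat 1\<rparr>"

definition scalars :: "(complex^3^3) set" where
  "scalars = {mat c | c. c \<noteq> 0}"

definition PGL3 :: "(complex^3^3) set monoid" where
  "PGL3 = GL3 Mod scalars"

definition pclass :: "complex^3^3 \<Rightarrow> (complex^3^3) set" where
  "pclass A = scalars #>\<^bsub>GL3\<^esub> A"

definition PGL3_topology :: "(complex^3^3) set topology" where
  "PGL3_topology = quotient_topology (top_of_set {A. invertible A}) pclass"

definition U21 :: "(complex^3^3) set" where
  "U21 = {A. invertible A \<and> (\<forall>z w. herm (A *v z) (A *v w) = herm z w)}"

definition PU21 :: "(complex^3^3) set set" where
  "PU21 = pclass ` U21"

text \<open>All representatives of \<open>g\<close> are applied to all representatives of \<open>p\<close>; the result is again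
  a projective point, see \<open>pact_pclass_proj\<close> below.\<close>

definition pact :: "(complex^3^3) set \<Rightarrow> (complex^3) set \<Rightarrow> (complex^3) set" where
  "pact g p = {A *v z | A z. A \<in> g \<and> z \<in> p}"


section \<open>Discrete groups and limit sets\<close>

definition discrete_subgroup :: "(complex^3^3) set set \<Rightarrow> bool" where
  "discrete_subgroup G \<longleftrightarrow>
     subgroup G PGL3 \<and> subtopology PGL3_topology G = discrete_topology G"

text \<open>
  The cluster points of the orbit of \<open>p\<close>. For discrete \<open>G \<subseteq> PU21\<close> this does not depend on the
  choice of \<open>p \<in> HC2\<close>.
\<close>

definition limit_set :: "(complex^3^3) set set \<Rightarrow> (complex^3) set \<Rightarrow> (complex^3) set set" where
  "limit_set G p =
     (subtopology P2C_topology (HC2 \<union> bdHC2)) derived_set_of ((\<lambda>g. pact g p) ` G)"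


section \<open>Regular knots in the boundary sphere\<close>

text \<open>
  The affine chart \<open>[w1 : w2 : 1] \<mapsto> (w1, w2)\<close> identifies the boundary with the unit sphere of
  \<open>C \<times> C\<close>, which is a smooth submanifold. So smoothness and derivatives of a curve in the boundary
  may be taken in \<open>C \<times> C\<close>. The circle carries the smooth structure for which \<open>cis\<close> is a local
  diffeomorphism from the real line.
\<close>

definition affine_chart :: "(complex^3) set \<Rightarrow> complex \<times> complex" where
  "affine_chart p = (THE w. p = proj (vector [fst w, snd w, 1]))"

definition Ck_curve :: "nat \<Rightarrow> (real \<Rightarrow> 'a::real_normed_vector) \<Rightarrow> bool" where
  "Ck_curve k f \<longleftrightarrow>
     (\<exists>D. D 0 = f \<and>
        (\<forall>i<k. \<forall>t. (D i has_vector_derivative D (Suc i) t) (at t)) \<and>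
        (\<forall>i\<le>k. continuous_on UNIV (D i)))"

text \<open>Only meaningful for \<open>k \<ge> 1\<close>.\<close>

definition regular_knot :: "nat \<Rightarrow> (complex \<Rightarrow> (complex^3) set) \<Rightarrow> bool" where
  "regular_knot k \<gamma> \<longleftrightarrow>
     \<gamma> ` sphere 0 1 \<subseteq> bdHC2 \<and> inj_on \<gamma> (sphere 0 1) \<and>
     Ck_curve k (\<lambda>t. affine_chart (\<gamma> (cis t))) \<and>
     (\<forall>t. vector_derivative (\<lambda>t. affine_chart (\<gamma> (cis t))) (at t) \<noteq> 0)"


section \<open>Chains and \<open>R\<close>-circles\<close>

definition chain :: "(complex^3) set set \<Rightarrow> bool" where
  "chain C \<longleftrightarrow> (\<exists>l. projective_line l \<and> l \<inter> HC2 \<noteq> {} \<and> C = l \<inter> bdHC2)"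

definition R_circle :: "(complex^3) set set \<Rightarrow> bool" where
  "R_circle C \<longleftrightarrow> (\<exists>h\<in>PU21. C = pact h ` (P2R \<inter> bdHC2))"


section \<open>Basic facts\<close>

lemma openin_quotient_topology:
  "openin (quotient_topology X q) U \<longleftrightarrow>
     U \<subseteq> q ` topspace X \<and> openin X {x \<in> topspace X. q x \<in> U}"
proof -
  have "istopology (\<lambda>U. U \<subseteq> q ` topspace X \<and> openin X {x \<in> topspace X. q x \<in> U})"
    unfolding istopology_def
  proof (intro conjI allI impI)
    fix S T
    assume "S \<subseteq> q ` topspace X \<and> openin X {x \<in> topspace X. q x \<in> S}"
      and "T \<subseteq> q ` topspace X \<and> openin X {x \<in> topspace X. q x \<in> T}"
    moreover have "{x \<in> topspace X. q x \<in> S \<inter> T} =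
        {x \<in> topspace X. q x \<in> S} \<inter> {x \<in> topspace X. q x \<in> T}"
      by auto
    ultimately show "S \<inter> T \<subseteq> q ` topspace X" "openin X {x \<in> topspace X. q x \<in> S \<inter> T}"
      by (auto simp: openin_Int)
  next
    fix K
    assume K: "\<forall>S\<in>K. S \<subseteq> q ` topspace X \<and> openin X {x \<in> topspace X. q x \<in> S}"
    then show "\<Union>K \<subseteq> q ` topspace X"
      by blast
    have "{x \<in> topspace X. q x \<in> \<Union>K} = (\<Union>S\<in>K. {x \<in> topspace X. q x \<in> S})"
      by auto
    with K show "openin X {x \<in> topspace X. q x \<in> \<Union>K}"
      by auto
  qed
  then show ?thesis
    by (simp add: quotient_topology_def topology_inverse')
qed

lemma topspace_quotient_topology [simp]: "topspace (quotient_topology X q) = q ` topspace X"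
proof -
  have "{x \<in> topspace X. q x \<in> q ` topspace X} = topspace X"
    by auto
  then have "openin (quotient_topology X q) (q ` topspace X)"
    by (simp add: openin_quotient_topology)
  then show ?thesis
    by (meson openin_quotient_topology openin_subset openin_topspace subset_antisym)
qed

lemma mat_mult_vec: "(mat c :: complex^3^3) *v z = c *s z"
  by (simp add: vec_eq_iff matrix_vector_mult_def mat_def forall_3 sum_3)

lemma mat_mult_mat: "(mat c :: complex^3^3) ** mat d = mat (c * d)"
  by (simp add: vec_eq_iff matrix_matrix_mult_def mat_def forall_3 sum_3)

lemma mat_mult_commute: "(mat c :: complex^3^3) ** A = A ** mat c"
proof -
  have "(\<Sum>k\<in>UNIV. (if i = k then c else 0) * A $ k $ j) = c * A $ i $ j" for i j
    by (subst sum.mono_neutral_right[of UNIV "{i}"]) auto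
  moreover have "(\<Sum>k\<in>UNIV. A $ i $ k * (if k = j then c else 0)) = c * A $ i $ j" for i j
    by (subst sum.mono_neutral_right[of UNIV "{j}"]) auto
  ultimately show ?thesis
    by (simp add: vec_eq_iff matrix_matrix_mult_def mat_def)
qed

lemma invertible_mat: "c \<noteq> 0 \<Longrightarrow> invertible (mat c :: complex^3^3)"
  unfolding invertible_def by (rule exI[of _ "mat (inverse c)"]) (simp add: mat_mult_mat)

lemma group_GL3: "group GL3"
proof (rule groupI)
  fix A assume "A \<in> carrier GL3"
  then obtain B where "A ** B = mat 1" "B ** A = mat 1"
    by (auto simp: GL3_def invertible_def)
  then show "\<exists>B\<in>carrier GL3. B \<otimes>\<^bsub>GL3\<^esub> A = \<one>\<^bsub>GL3\<^esub>"
    by (auto simp: GL3_def invertible_def)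
qed (auto simp: GL3_def invertible_mult matrix_mul_assoc invertible_mat)

lemma normal_scalars: "scalars \<lhd> GL3"
proof -
  interpret group GL3 by (rule group_GL3)
  have "subgroup scalars GL3"
  proof (rule subgroupI)
    show "scalars \<subseteq> carrier GL3"
      by (auto simp: scalars_def GL3_def invertible_mat)
    show "scalars \<noteq> {}"
      by (auto simp: scalars_def intro: exI[of _ 1])
  next
    fix A assume "A \<in> scalars"
    then obtain c where c: "A = mat c" "c \<noteq> 0"
      by (auto simp: scalars_def)
    have "inv\<^bsub>GL3\<^esub> A = mat (inverse c)"
      using c by (intro inv_equality) (auto simp: GL3_def mat_mult_mat invertible_mat)
    then show "inv\<^bsub>GL3\<^esub> A \<in> scalars"
      using c by (auto simp: scalars_def)
  next
    fix A B assume "A \<in> scalars" "B \<in> scalars"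
    then show "A \<otimes>\<^bsub>GL3\<^esub> B \<in> scalars"
      by (auto simp: scalars_def GL3_def mat_mult_mat)
  qed
  then show ?thesis
    by (rule normalI) (auto simp: r_coset_def l_coset_def scalars_def GL3_def mat_mult_commute)
qed

lemma group_PGL3: "group PGL3"
  unfolding PGL3_def by (rule normal.factorgroup_is_group[OF normal_scalars])

lemma topspace_PGL3_topology: "topspace PGL3_topology = carrier PGL3"
  by (auto simp: PGL3_topology_def PGL3_def FactGroup_def RCOSETS_def pclass_def GL3_def)

lemma pclass_eq: "pclass A = {mat c ** A | c. c \<noteq> 0}"
  by (auto simp: pclass_def r_coset_def scalars_def GL3_def)

lemma pclass_mult:
  assumes "invertible A" "invertible B"
  shows "pclass A \<otimes>\<^bsub>PGL3\<^esub> pclass B = pclass (A ** B)"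
  using normal.rcos_sum[OF normal_scalars, of A B] assms
  by (simp add: PGL3_def FactGroup_def pclass_def GL3_def)

lemma herm_scale: "herm (c *s z) (d *s w) = c * cnj d * herm z w"
  by (simp add: herm_def algebra_simps)

lemma pact_pclass_proj: "pact (pclass A) (proj z) = proj (A *v z)"
proof -
  have 1: "(mat c ** A) *v (d *s z) = (c * d) *s (A *v z)" for c d
    by (simp add: matrix_vector_mul_assoc[symmetric] mat_mult_vec vec.scale)
  have 2: "\<exists>c' d. c *s (A *v z) = (mat c' ** A) *v (d *s z) \<and> c' \<noteq> 0 \<and> d \<noteq> 0"
    if "c \<noteq> 0" for c
    using that by (intro exI[of _ c] exI[of _ 1]) (simp only: 1 mult_1_right, simp)
  show ?thesis
  proof (intro subset_antisym subsetI)
    fix x assume "x \<in> pact (pclass A) (proj z)"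
    then obtain c d where "c \<noteq> 0" "d \<noteq> 0" "x = (mat c ** A) *v (d *s z)"
      unfolding pact_def pclass_eq proj_def by blast
    then have "x = (c * d) *s (A *v z)" "c * d \<noteq> 0"
      by (simp_all only: 1 mult_eq_0_iff de_Morgan_disj simp_thms)
    then show "x \<in> proj (A *v z)"
      unfolding proj_def by blast
  next
    fix x assume "x \<in> proj (A *v z)"
    then obtain c where "x = c *s (A *v z)" "c \<noteq> 0"
      unfolding proj_def by blast
    with 2[of c] show "x \<in> pact (pclass A) (proj z)"
      unfolding pact_def pclass_eq proj_def by blast
  qed
qed

lemma affine_chart_proj: "affine_chart (proj (vector [a, b, 1])) = (a, b)"
  unfolding affine_chart_def
proof (rule the_equality)
  fix w assume "proj (vector [a, b, 1]) = proj (vector [fst w, snd w, 1])"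
  moreover have "vector [a, b, 1] \<in> proj (vector [a, b, 1])"
    unfolding proj_def by (auto intro!: exI[of _ 1])
  ultimately obtain c where "vector [a, b, 1] = c *s (vector [fst w, snd w, 1] :: complex^3)"
    by (auto simp: proj_def)
  then show "w = (a, b)"
    by (auto simp: vec_eq_iff forall_3 prod_eq_iff)
qed simp

end

theory Submission
  imports Defs "HOL-Computational_Algebra.Fundamental_Theorem_Algebra"
begin

text \<open>
  Write \<open>H\<close> for the group of unitary matrices that represent elements of \<open>G\<close>, and describe the knot
  by the curve \<open>W t = (w1, w2, 1)\<close> of null vectors. The limit set is invariant under \<open>H\<close>, and a
  loxodromic element of \<open>H\<close> contracts it towards its attracting fixed point \<open>a\<close>. A smooth curve that
  is invariant under a linear contraction is rigid: it coincides with its leading Taylor term at the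
  fixed point. This turns the local regularity of the knot into global equations.

  Let \<open>A \<in> H\<close> be loxodromic with attracting null vector \<open>a\<close>, repelling null vector \<open>b\<close> and
  \<open>\<langle>a, b\<rangle> = 1\<close>, and let \<open>c\<close> be the unit vector orthogonal to both. The coordinates of \<open>z\<close> are
  \<open>Zb = \<langle>z, b\<rangle>\<close>, \<open>Zc = \<langle>z, c\<rangle>\<close> and \<open>Za = \<langle>z, a\<rangle>\<close> (the coefficients of \<open>a\<close>, \<open>c\<close> and \<open>b\<close>); \<open>A\<close> multiplies
  them by \<open>l\<close>, \<open>u\<close> and \<open>1 / cnj l\<close> with \<open>\<bar>l\<bar> > 1 = \<bar>u\<bar>\<close>. If \<open>q\<close> is a limit point other
  than \<open>a\<close> and \<open>b\<close>, then \<open>A^n q\<close> runs along the knot into \<open>a\<close>, so for a function \<open>R\<close> of the projective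
  point the numbers \<open>R (A^n q)\<close> have the same limit as \<open>R (W t)\<close> at the parameter of \<open>a\<close> (lemma \<open>orbit_ratio_limit\<close>).

  \<^item> Suppose that the knot is transverse to the contact plane at \<open>a\<close>, that is \<open>\<langle>W', W\<rangle> \<noteq> 0\<close> there. Then
    \<open>Zc / Za\<close> has a limit along the knot, but \<open>A\<close> expands it by the factor \<open>\<bar>l\<bar>\<close>; hence \<open>Zc = 0\<close> on
    the whole limit set, which is therefore the chain through \<open>a\<close> and \<open>b\<close> (\<open>transverse_limit_cone\<close>).

  \<^item> Suppose that the knot is tangent to the contact plane at \<open>a\<close>. Second derivatives give a limit
    of \<open>Za Zb / Zc^2\<close>, which \<open>A\<close> multiplies by a unit. So this ratio is constant on the limit set,
    and the argument of \<open>Zc / Zb\<close> is constant up to sign. The limit set is the parabola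
    \<open>Zc / Zb = x w\<close>, \<open>Za / Zb = M x^2\<close> with \<open>x\<close> real, \<open>\<bar>w\<bar> = 1\<close> and \<open>Re M = - 1 / 2\<close>
    (\<open>tangent_parabola\<close>). If \<open>M\<close> is real, this is an \<open>R\<close>-circle. If not, the parabola is transverse to
    the contact planes away from \<open>a\<close> and \<open>b\<close> (\<open>bent_parabola_transverse\<close>), and a loxodromic element
    with attracting point elsewhere leads back to the first case.

  It remains to find loxodromic elements. If no element of \<open>H\<close> has an eigenvalue outside the unit disc,
  all traces are bounded by \<open>3\<close>. Then a rescaled limit of matrices going to infinity has rank one, its
  range is a null line, and the trace condition forces \<open>H\<close> to fix this line, with eigenvalues of modulus
  one; so the limit set is this single point (\<open>exists_expanding\<close>). Conjugation by an element that does
  not preserve the pair of fixed points moves the attracting point, and such an element exists because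
  otherwise the limit set would be this pair (\<open>limit_cone_invariant_pair\<close>). Both exclusions rest on
  functions such as \<open>\<bar>\<langle>z, a\<rangle> \<langle>z, b\<rangle>\<bar> / \<bar>\<langle>z, z\<rangle>\<bar>\<close>, which are constant on orbits and infinite at all other
  boundary points.
\<close>

section \<open>The Hermitian form and frames of null vectors\<close>

lemma herm_add_left: "herm (x + y) z = herm x z + herm y z"
  by (simp add: herm_def algebra_simps)
lemma herm_diff_left: "herm (x - y) z = herm x z - herm y z"
  by (simp add: herm_def algebra_simps)
lemma herm_add_right: "herm z (x + y) = herm z x + herm z y"
  by (simp add: herm_def algebra_simps)
lemma herm_diff_right: "herm z (x - y) = herm z x - herm z y"
  by (simp add: herm_def algebra_simps)
lemma herm_scale_left: "herm (c *s x) z = c * herm x z"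
  by (simp add: herm_def algebra_simps)
lemma herm_scale_right: "herm z (c *s x) = cnj c * herm z x"
  by (simp add: herm_def algebra_simps)
lemma herm_zero [simp]: "herm 0 z = 0" "herm z 0 = 0"
  by (simp_all add: herm_def)
lemma herm_cnj: "cnj (herm z w) = herm w z"
  by (simp add: herm_def algebra_simps)

lemmas herm_linear = herm_add_left herm_diff_left herm_add_right herm_diff_right
  herm_scale_left herm_scale_right

lemma herm_self: "herm z z = of_real ((cmod (z$1))\<^sup>2 + (cmod (z$2))\<^sup>2 - (cmod (z$3))\<^sup>2)"
  by (simp add: herm_def complex_norm_square[symmetric])

lemma herm_eq_0_swap: "herm z w = 0 \<longleftrightarrow> herm w z = 0"
  by (metis complex_cnj_zero_iff herm_cnj)

lemma herm_nondegenerate: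
  assumes "\<And>x. herm x v = 0"
  shows "v = 0"
  using assms[of "axis 1 1"] assms[of "axis 2 1"] assms[of "axis 3 1"]
  by (simp add: herm_def axis_def vec_eq_iff forall_3)

text \<open>
  On a null vector the third coordinate carries the whole negative part of the form. It serves to
  normalise null vectors, both here and for the affine chart.
\<close>

lemma null_third_nonzero:
  assumes "herm z z = 0" "z \<noteq> 0"
  shows "z$3 \<noteq> 0"
proof
  assume "z$3 = 0"
  with assms(1) have "(cmod (z$1))\<^sup>2 + (cmod (z$2))\<^sup>2 = 0"
    by (simp add: herm_self flip: of_real_add of_real_power)
  then have "z = 0"
    using \<open>z$3 = 0\<close> by (simp add: vec_eq_iff forall_3 sum_power2_eq_zero_iff)
  with assms(2) show False by simp
qed

text \<open>
  In signature \<open>(2, 1)\<close> an isotropic subspace has dimension at most one: the combination of \<open>a\<close> and \<open>b\<close>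
  with vanishing third coordinate is again null, hence zero.
\<close>

lemma null_orthogonal_proportional:
  assumes "herm a a = 0" "herm b b = 0" "herm a b = 0" "a \<noteq> 0"
  obtains c where "b = c *s a"
proof -
  have a3: "a$3 \<noteq> 0" using assms null_third_nonzero by blast
  define c where "c = b$3 / a$3"
  have "herm b a = 0" using assms(3) herm_eq_0_swap by blast
  then have "herm (b - c *s a) (b - c *s a) = 0"
    using assms by (simp add: herm_linear)
  moreover have "(b - c *s a)$3 = 0" using a3 by (simp add: c_def)
  ultimately have "b - c *s a = 0" using null_third_nonzero by blast
  then have "b = c *s a" by simp
  then show ?thesis by (rule that)
qed

text \<open>
  The unit vector \<open>c\<close> spans the positive line orthogonal to the hyperbolic plane of \<open>a\<close> and \<open>b\<close>. In a frame
  the coefficient of \<open>a\<close> in \<open>z\<close> is \<open>herm z b\<close>, that of \<open>b\<close> is \<open>herm z a\<close>.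
\<close>

definition null_frame :: "complex^3 \<Rightarrow> complex^3 \<Rightarrow> complex^3 \<Rightarrow> bool" where
  "null_frame a b c \<longleftrightarrow> herm a a = 0 \<and> herm b b = 0 \<and> herm a b = 1 \<and>
     herm a c = 0 \<and> herm b c = 0 \<and> herm c c = 1"

lemma null_frame_exists:
  assumes "herm a a = 0" "herm b b = 0" "herm a b = 1"
  obtains c where "null_frame a b c"
proof -
  \<comment> \<open>the cross product of \<open>a\<close> and \<open>b\<close>, conjugated and with the sign of the form\<close>
  define c :: "complex^3" where "c = vector [cnj (a$2 * b$3 - a$3 * b$2),
      cnj (a$3 * b$1 - a$1 * b$3), - cnj (a$1 * b$2 - a$2 * b$1)]"
  have "herm c c = herm a b * herm b a - herm a a * herm b b"
    by (simp add: c_def herm_def algebra_simps)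
  moreover have "herm b a = 1" using assms(3) herm_cnj[of a b] by simp
  moreover have "herm a c = 0" "herm b c = 0"
    by (simp_all add: c_def herm_def algebra_simps)
  ultimately show ?thesis using that assms unfolding null_frame_def by auto
qed

lemma null_frameD:
  assumes "null_frame a b c"
  shows "herm a a = 0" "herm b b = 0" "herm a b = 1" "herm b a = 1" "herm a c = 0"
    "herm c a = 0" "herm b c = 0" "herm c b = 0" "herm c c = 1" "a \<noteq> 0" "b \<noteq> 0"
  using assms herm_eq_0_swap herm_cnj[of a b] unfolding null_frame_def by auto

lemma null_frame_expand:
  assumes "null_frame a b c"
  shows "z = herm z b *s a + herm z a *s b + herm z c *s c"
proof -
  note f = null_frameD[OF assms]
  define M :: "complex^3^3" where "M = (\<chi> i j. (vector [a, b, c] :: complex^3^3)$j$i)"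
  \<comment> \<open>\<open>N\<close> computes the coordinates of a vector and \<open>M\<close> reassembles the vector from them\<close>
  define N :: "complex^3^3" where
    "N = (\<chi> i. \<chi> j. (vector [1, 1, -1] :: complex^3)$j * cnj ((vector [b, a, c] :: complex^3^3)$i$j))"
  have N: "N *v x = vector [herm x b, herm x a, herm x c]" for x
    by (simp add: N_def vec_eq_iff forall_3 matrix_vector_mult_def sum_3 herm_def algebra_simps)
  have M: "M *v y = y$1 *s a + y$2 *s b + y$3 *s c" for y
    by (simp add: M_def vec_eq_iff forall_3 matrix_vector_mult_def sum_3 algebra_simps)
  have "N *v (M *v y) = y" for y
    unfolding N M by (simp add: vec_eq_iff forall_3 herm_linear f)
  then have "N ** M = mat 1"
    by (simp add: matrix_eq flip: matrix_vector_mul_assoc)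
  then have "M ** N = mat 1"
    using matrix_left_right_inverse by blast
  then have "M *v (N *v z) = z" by (simp add: matrix_vector_mul_assoc)
  then show ?thesis unfolding N M by simp
qed

lemma null_frame_herm:
  assumes "null_frame a b c"
  shows "herm z w = herm z b * cnj (herm w a) + herm z a * cnj (herm w b) + herm z c * cnj (herm w c)"
proof -
  have "herm z w = herm z (herm w b *s a + herm w a *s b + herm w c *s c)"
    using null_frame_expand[OF assms] by metis
  then show ?thesis by (simp add: herm_linear mult.commute)
qed

lemma null_frame_Re_herm_self:
  assumes "null_frame a b c"
  shows "Re (herm z z) = 2 * Re (herm z b * cnj (herm z a)) + (cmod (herm z c))\<^sup>2"
  using arg_cong[OF null_frame_herm[OF assms, of z z], of Re]
  by (simp only: cmod_power2) (simp add: power2_eq_square algebra_simps)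

section \<open>Loxodromic unitary matrices\<close>

lemma U21_herm: "A \<in> U21 \<Longrightarrow> herm (A *v z) (A *v w) = herm z w"
  and U21_invertible: "A \<in> U21 \<Longrightarrow> invertible A"
  by (auto simp: U21_def)

lemma singular_has_kernel:
  fixes A :: "complex^'n^'n"
  assumes "det A = 0"
  obtains v where "v \<noteq> 0" "A *v v = 0"
  using assms invertible_det_nz[of A] invertible_left_inverse[of A]
  by (metis matrix_left_invertible_ker)

text \<open>
  The trace is the sum of the three roots of the characteristic polynomial. In the contrapositive form
  this produces an eigenvalue outside the unit disc from a large trace.
\<close>

lemma trace_bounded_by_eigenvalues:
  fixes A :: "complex^3^3"
  assumes "\<And>l v. v \<noteq> 0 \<Longrightarrow> A *v v = l *s v \<Longrightarrow> cmod l \<le> 1"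
  shows "cmod (trace A) \<le> 3"
proof -
  \<comment> \<open>the sum of the principal minors of order two\<close>
  define m where "m = A$1$1 * A$2$2 - A$1$2 * A$2$1 + A$1$1 * A$3$3 - A$1$3 * A$3$1
     + A$2$2 * A$3$3 - A$2$3 * A$3$2"
  have ch: "det (A - mat x) = - (x^3 - trace A * x^2 + m * x - det A)" for x
    by (simp add: det_3 trace_def sum_3 mat_def m_def power3_eq_cube power2_eq_square algebra_simps)
  have root: "cmod x \<le> 1" if "x^3 - trace A * x^2 + m * x - det A = 0" for x
  proof -
    have "det (A - mat x) = 0" using ch that by simp
    then obtain v where "v \<noteq> 0" "(A - mat x) *v v = 0" using singular_has_kernel by blast
    then have "A *v v = x *s v"
      by (simp add: matrix_vector_mult_diff_rdistrib mat_mult_vec)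
    then show ?thesis using assms \<open>v \<noteq> 0\<close> by blast
  qed
  define P where "P = [: - det A, m, - trace A, 1 :]"
  have P: "P \<noteq> 0" "degree P = 3" "lead_coeff P = 1"
    by (simp_all add: P_def)
  obtain X where "size X = 3" and X: "P = (\<Prod>x\<in>#X. [:-x, 1:])"
    using alg_closed_imp_factorization[OF P(1)] P by auto
  then obtain x y z where "X = {#x, y, z#}"
    by (auto simp: numeral_3_eq_3 elim!: size_mset_SucE)
  with X have xyz: "P = [:-x, 1:] * [:-y, 1:] * [:-z, 1:]"
    by (simp add: algebra_simps)
  have "poly P w = w^3 - trace A * w^2 + m * w - det A" for w
    by (simp add: P_def power3_eq_cube power2_eq_square algebra_simps)
  moreover have "poly P x = 0" "poly P y = 0" "poly P z = 0"
    unfolding xyz poly_mult by simp_all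
  ultimately have "cmod x \<le> 1" "cmod y \<le> 1" "cmod z \<le> 1"
    by (auto intro!: root)
  moreover have "trace A = x + y + z"
    using arg_cong[OF xyz, of "\<lambda>p. - coeff p 2"] by (simp add: P_def numeral_2_eq_2 algebra_simps)
  ultimately show ?thesis
    using norm_triangle_ineq[of "x + y" z] norm_triangle_ineq[of x y] by simp
qed

lemma mult_vec_scale: "A *v (c *s z) = c *s (A *v z)" for A :: "complex^3^3"
  by (simp add: vec.scale)

lemma matrix_inv_mult:
  fixes A :: "complex^3^3"
  assumes "invertible A"
  shows "A ** matrix_inv A = mat 1" "matrix_inv A ** A = mat 1"
  using someI_ex[of "\<lambda>B. A ** B = mat 1 \<and> B ** A = mat 1"] assms
  unfolding invertible_def matrix_inv_def by blast+

lemma matrix_inv_vec: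
  fixes A :: "complex^3^3"
  assumes "invertible A"
  shows "matrix_inv A *v (A *v z) = z" "A *v (matrix_inv A *v z) = z"
  using assms by (simp_all add: matrix_vector_mul_assoc matrix_inv_mult)

lemma U21_mult: "A \<in> U21 \<Longrightarrow> B \<in> U21 \<Longrightarrow> A ** B \<in> U21"
  by (auto simp: U21_def invertible_mult simp flip: matrix_vector_mul_assoc)

lemma U21_inv:
  assumes "A \<in> U21"
  shows "matrix_inv A \<in> U21"
proof -
  have "herm (matrix_inv A *v z) (matrix_inv A *v w) = herm z w" for z w
    using U21_herm[OF assms, of "matrix_inv A *v z" "matrix_inv A *v w"]
    by (simp add: matrix_inv_vec U21_invertible[OF assms])
  then show ?thesis
    using matrix_inv_mult[OF U21_invertible[OF assms]] by (auto simp: U21_def invertible_def)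
qed

lemma U21_vec_nonzero:
  assumes "A \<in> U21" "z \<noteq> 0"
  shows "A *v z \<noteq> 0"
  using matrix_inv_vec(1)[OF U21_invertible[OF assms(1)], of z] assms(2)
  by (metis mult_vec_scale vec.scale_zero_left)

lemma U21_herm_inv:
  assumes "A \<in> U21"
  shows "herm (A *v x) y = herm x (matrix_inv A *v y)"
  using U21_herm[OF assms, of x "matrix_inv A *v y"]
  by (simp add: matrix_inv_vec U21_invertible[OF assms])

lemma U21_inv_eigenvector:
  assumes "A \<in> U21" "A *v v = l *s v" "l \<noteq> 0"
  shows "matrix_inv A *v v = (1 / l) *s v"
proof -
  have "v = l *s (matrix_inv A *v v)"
    using matrix_inv_vec(1)[OF U21_invertible[OF assms(1)], of v] assms(2)
    by (simp add: mult_vec_scale)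
  then have "(1 / l) *s v = (1 / l) *s (l *s (matrix_inv A *v v))" by simp
  then show ?thesis using assms(3) by simp
qed

text \<open>
  Since \<open>A - l\<close> is singular, some nonzero \<open>b\<close> is orthogonal to its range. Unitarity turns the relation
  \<open>herm (A *v x) b = l * herm x b\<close> into the eigenvalue equation for \<open>b\<close>. So the spectrum is invariant under
  reflection in the unit circle.
\<close>

lemma U21_reflected_eigenvalue:
  assumes A: "A \<in> U21" and "a \<noteq> 0" and Aa: "A *v a = l *s a"
  obtains b where "b \<noteq> 0" "A *v b = (1 / cnj l) *s b"
proof -
  have "l \<noteq> 0" using U21_vec_nonzero[OF A \<open>a \<noteq> 0\<close>] Aa by auto
  define D where "D = A - mat l"
  have "D *v a = 0" using Aa
    by (simp add: D_def matrix_vector_mult_diff_rdistrib mat_mult_vec)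
  with \<open>a \<noteq> 0\<close> have "\<not> invertible D"
    by (metis invertible_left_inverse matrix_left_invertible_ker)
  then have "det (transpose D) = 0" by (simp add: invertible_det_nz)
  then obtain v where v: "v \<noteq> 0" "transpose D *v v = 0" using singular_has_kernel by blast
  define b :: "complex^3" where "b = vector [cnj (v$1), cnj (v$2), - cnj (v$3)]"
  have "b \<noteq> 0" using v(1) by (simp add: b_def vec_eq_iff forall_3)
  have "herm (D *v x) b = (\<Sum>i\<in>UNIV. (transpose D *v v)$i * x$i)" for x
    by (simp add: herm_def b_def matrix_vector_mult_def transpose_def sum_3 algebra_simps)
  then have D0: "herm (D *v x) b = 0" for x using v(2) by simp
  have "herm x (b - cnj l *s (A *v b)) = 0" for x
  proof -
    define y where "y = matrix_inv A *v x"
    have y: "A *v y = x" by (simp add: y_def matrix_inv_vec U21_invertible[OF A])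
    have "herm (A *v y) b = l * herm y b"
      using D0[of y]
      by (simp add: D_def matrix_vector_mult_diff_rdistrib mat_mult_vec herm_linear)
    also have "\<dots> = herm (A *v y) (cnj l *s (A *v b))"
      by (simp add: herm_linear U21_herm[OF A])
    finally show ?thesis by (simp add: y herm_linear)
  qed
  then have eq: "b = cnj l *s (A *v b)" using herm_nondegenerate by fastforce
  have "A *v b = (1 / cnj l) *s (cnj l *s (A *v b))"
    using \<open>l \<noteq> 0\<close> by simp
  also have "\<dots> = (1 / cnj l) *s b" using eq by metis
  finally show ?thesis using that \<open>b \<noteq> 0\<close> by blast
qed

lemma U21_eigenvector_null:
  assumes "A \<in> U21" "A *v a = l *s a" "cmod l \<noteq> 1"
  shows "herm a a = 0"
proof -
  have "herm a a = (l * cnj l) * herm a a"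
    using U21_herm[OF assms(1), of a a] by (simp only: assms(2) herm_scale)
  then have "herm a a = 0 \<or> l * cnj l = 1" by (metis mult_cancel_right1)
  then show ?thesis using assms(3)
    by (metis complex_norm_square norm_ge_zero norm_of_real norm_one of_real_eq_1_iff power2_eq_1_iff
        power2_eq_square real_sqrt_abs real_sqrt_one abs_of_nonneg)
qed

text \<open>
  The frame diagonalises \<open>A\<close>: the attracting point is \<open>a\<close>, the repelling point is \<open>b\<close>, and \<open>u\<close> rotates the
  normal direction of the complex geodesic between them.
\<close>

definition loxodromic_frame ::
  "complex^3^3 \<Rightarrow> complex \<Rightarrow> complex \<Rightarrow> complex^3 \<Rightarrow> complex^3 \<Rightarrow> complex^3 \<Rightarrow> bool" where
  "loxodromic_frame A l u a b c \<longleftrightarrow> null_frame a b c \<and> A *v a = l *s a \<and>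
     A *v b = (1 / cnj l) *s b \<and> A *v c = u *s c \<and> cmod l > 1 \<and> cmod u = 1"

text \<open>
  One eigenvalue off the unit circle suffices: its reflection supplies the second null direction, and the
  orthogonal complement of the two is invariant.
\<close>

lemma loxodromic_frame_exists:
  assumes A: "A \<in> U21" and a: "a \<noteq> 0" "A *v a = l *s a" and l: "cmod l > 1"
  obtains u b c where "loxodromic_frame A l u a b c"
proof -
  have l0: "l \<noteq> 0" using l by auto
  obtain b0 where b0: "b0 \<noteq> 0" "A *v b0 = (1 / cnj l) *s b0"
    using U21_reflected_eigenvalue[OF A a] by blast
  have "cmod (1 / cnj l) < 1" using l by (simp add: norm_divide divide_less_eq)
  then have null: "herm a a = 0" "herm b0 b0 = 0"
    using U21_eigenvector_null[OF A] a b0 l by fastforce+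
  have "herm a b0 \<noteq> 0"
  proof
    assume "herm a b0 = 0"
    then obtain k where k: "b0 = k *s a"
      using null_orthogonal_proportional null a(1) by blast
    have "(1 / cnj l) *s b0 = l *s b0"
      unfolding b0(2)[symmetric] by (simp add: k mult_vec_scale a(2) mult.commute)
    then have "1 / cnj l = l" using b0(1) by (simp add: vec.scale_right_imp_eq)
    then show False using \<open>cmod (1 / cnj l) < 1\<close> l by simp
  qed
  define b where "b = (1 / cnj (herm a b0)) *s b0"
  have "herm b b = 0" "herm a b = 1"
    using null \<open>herm a b0 \<noteq> 0\<close> by (simp_all add: b_def herm_linear)
  then obtain c where fr: "null_frame a b c" using null_frame_exists null(1) by blast
  note f = null_frameD[OF fr]
  have Ab: "A *v b = (1 / cnj l) *s b"
    by (simp add: b_def mult_vec_scale b0(2) mult.commute)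
  have "herm (A *v c) (l *s a) = 0" "herm (A *v c) ((1 / cnj l) *s b) = 0"
    using U21_herm[OF A, of c a] U21_herm[OF A, of c b] f a(2) Ab by simp_all
  then have "herm (A *v c) a = 0" "herm (A *v c) b = 0"
    using l0 by (simp_all add: herm_linear)
  then have Ac: "A *v c = herm (A *v c) c *s c"
    using null_frame_expand[OF fr, of "A *v c"] by simp
  define u where "u = herm (A *v c) c"
  have "u * cnj u = 1"
    using U21_herm[OF A, of c c] f by (metis Ac u_def herm_scale mult_1_right)
  then have "(cmod u)\<^sup>2 = 1" by (metis complex_norm_square of_real_eq_1_iff)
  then have "cmod u = 1" by (simp add: power2_eq_1_iff) (smt (verit) norm_ge_zero)
  then show ?thesis
    using that[of u b c] fr a(2) Ab Ac l unfolding loxodromic_frame_def u_def by auto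
qed

lemma loxodromic_frameD:
  assumes "loxodromic_frame A l u a b c"
  shows "null_frame a b c" "A *v a = l *s a" "A *v b = (1 / cnj l) *s b" "A *v c = u *s c"
    "cmod l > 1" "cmod u = 1" "l \<noteq> 0" "u \<noteq> 0"
  using assms unfolding loxodromic_frame_def by auto

lemma loxodromic_frame_coordinates:
  assumes "loxodromic_frame A l u a b c"
  shows "herm (A *v z) b = l * herm z b" "herm (A *v z) a = (1 / cnj l) * herm z a"
    "herm (A *v z) c = u * herm z c"
proof -
  note d = loxodromic_frameD[OF assms]
  note f = null_frameD[OF d(1)]
  have "A *v z = A *v (herm z b *s a + herm z a *s b + herm z c *s c)"
    using null_frame_expand[OF d(1)] by metis
  also have "\<dots> = herm z b *s (l *s a) + herm z a *s ((1 / cnj l) *s b) + herm z c *s (u *s c)"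
    by (simp only: matrix_vector_right_distrib mult_vec_scale d)
  finally have *: "A *v z = \<dots>" .
  show "herm (A *v z) b = l * herm z b" "herm (A *v z) a = (1 / cnj l) * herm z a"
    "herm (A *v z) c = u * herm z c"
    unfolding * by (simp_all add: herm_linear f del: vec.scale_scale)
qed

lemma loxodromic_frame_inverse:
  assumes "A \<in> U21" "loxodromic_frame A l u a b c"
  shows "loxodromic_frame (matrix_inv A) (cnj l) (1 / u) b a c"
proof -
  note d = loxodromic_frameD[OF assms(2)]
  have "null_frame b a c" using null_frameD[OF d(1)] unfolding null_frame_def by simp
  moreover have "matrix_inv A *v b = cnj l *s b"
    using U21_inv_eigenvector[OF assms(1) d(3)] d(7) by simp
  ultimately show ?thesis
    using U21_inv_eigenvector[OF assms(1) d(2)] U21_inv_eigenvector[OF assms(1) d(4)] d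
    unfolding loxodromic_frame_def by (simp add: norm_divide)
qed

lemma loxodromic_frame_conjugate:
  assumes "h \<in> U21" "loxodromic_frame A l u a b c"
  shows "loxodromic_frame (h ** A ** matrix_inv h) l u (h *v a) (h *v b) (h *v c)"
proof -
  note d = loxodromic_frameD[OF assms(2)]
  have "null_frame (h *v a) (h *v b) (h *v c)"
    using d(1) unfolding null_frame_def by (simp add: U21_herm[OF assms(1)])
  moreover have "(h ** A ** matrix_inv h) *v (h *v z) = h *v (A *v z)" for z
    by (simp only: matrix_vector_mul_assoc[symmetric] matrix_inv_vec[OF U21_invertible[OF assms(1)]])
  ultimately show ?thesis
    using d unfolding loxodromic_frame_def by (simp add: mult_vec_scale)
qed

section \<open>The cone over the limit set of an orbit\<close>

lemma tendsto_scale: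
  fixes z :: "'a \<Rightarrow> complex^3"
  assumes "(c \<longlongrightarrow> c') F" "(z \<longlongrightarrow> z') F"
  shows "((\<lambda>x. c x *s z x) \<longlongrightarrow> c' *s z') F"
  by (intro vec_tendstoI) (auto intro!: tendsto_mult tendsto_vec_nth assms)

lemma tendsto_mult_vec:
  fixes z :: "'a \<Rightarrow> complex^3" and A :: "'a \<Rightarrow> complex^3^3"
  assumes "(A \<longlongrightarrow> A') F" "(z \<longlongrightarrow> z') F"
  shows "((\<lambda>x. A x *v z x) \<longlongrightarrow> A' *v z') F"
  by (intro vec_tendstoI) (auto simp: matrix_vector_mult_def intro!: tendsto_sum tendsto_mult tendsto_vec_nth assms)

lemma tendsto_herm [tendsto_intros]:
  assumes "(z \<longlongrightarrow> z') F" "(w \<longlongrightarrow> w') F"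
  shows "((\<lambda>x. herm (z x) (w x)) \<longlongrightarrow> herm z' w') F"
  unfolding herm_def by (intro tendsto_intros tendsto_vec_nth assms)

lemma loxodromic_frame_power_coordinates:
  assumes "loxodromic_frame A l u a b c"
  shows "herm (((*v) A ^^ n) z) b = l ^ n * herm z b"
    "herm (((*v) A ^^ n) z) a = (1 / cnj l) ^ n * herm z a"
    "herm (((*v) A ^^ n) z) c = u ^ n * herm z c"
  by (induction n) (simp_all add: loxodromic_frame_coordinates[OF assms])

text \<open>
  Relative to the dominant coordinate the other two decay like \<open>\<bar>l\<bar>^(- 2 n)\<close> and \<open>\<bar>l\<bar>^(- n)\<close>.
\<close>

lemma loxodromic_power_converges:
  assumes "loxodromic_frame A l u a b c"
  shows "(\<lambda>n. (1 / l) ^ n *s ((*v) A ^^ n) z) \<longlonglongrightarrow> herm z b *s a"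
proof -
  note d = loxodromic_frameD[OF assms]
  have "(1 / l) ^ n *s ((*v) A ^^ n) z =
      herm z b *s a + ((1 / (l * cnj l)) ^ n * herm z a) *s b + ((u / l) ^ n * herm z c) *s c" for n
  proof -
    have "(1 / l) ^ n *s ((*v) A ^^ n) z = ((1 / l) ^ n * (l ^ n * herm z b)) *s a
       + ((1 / l) ^ n * ((1 / cnj l) ^ n * herm z a)) *s b + ((1 / l) ^ n * (u ^ n * herm z c)) *s c"
      by (subst null_frame_expand[OF d(1), of "((*v) A ^^ n) z"])
        (simp only: loxodromic_frame_power_coordinates[OF assms] vec.scale_right_distrib vec.scale_scale)
    then show ?thesis using d(7) by (simp add: power_divide power_mult_distrib)
  qed
  moreover have "(\<lambda>n. (1 / (l * cnj l)) ^ n) \<longlonglongrightarrow> 0"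
    using d(5,7) mult_strict_mono[of 1 "cmod l" 1 "cmod l"]
    by (intro LIMSEQ_power_zero) (auto simp: norm_divide norm_mult divide_less_eq)
  moreover have "(\<lambda>n. (u / l) ^ n) \<longlonglongrightarrow> 0"
    using d by (intro LIMSEQ_power_zero) (simp add: norm_divide divide_less_eq)
  ultimately have "(\<lambda>n. (1 / l) ^ n *s ((*v) A ^^ n) z) \<longlonglongrightarrow>
      herm z b *s a + (0 * herm z a) *s b + (0 * herm z c) *s c"
    by (simp only:) (intro tendsto_add tendsto_scale tendsto_mult tendsto_const)
  then show ?thesis by simp
qed

lemma null_frame_negative:
  assumes "null_frame a b c" "Re (herm z z) < 0"
  shows "herm z b \<noteq> 0"
proof
  assume "herm z b = 0"
  then have "Re (herm z z) = (cmod (herm z c))\<^sup>2"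
    using null_frame_Re_herm_self[OF assms(1)] by simp
  then show False using assms(2) by simp
qed

text \<open>
  Working with vectors instead of projective points keeps the limit arguments elementary: \<open>H\<close> stands for the
  matrices over the group, \<open>p\<close> for a negative vector over the base point.
\<close>

locale unitary_orbit =
  fixes H :: "(complex^3^3) set" and p :: "complex^3"
  assumes H_U21: "A \<in> H \<Longrightarrow> A \<in> U21"
    and H_mult: "A \<in> H \<Longrightarrow> B \<in> H \<Longrightarrow> A ** B \<in> H"
    and H_inv: "A \<in> H \<Longrightarrow> matrix_inv A \<in> H"
    and H_nonempty: "H \<noteq> {}"
    and p_negative: "Re (herm p p) < 0"
begin

text \<open>
  The null vectors over the limit set. Orbit points are negative vectors, so none of them is
  proportional to a null vector, and a cluster point is the same as a limit.
\<close>

definition limit_cone :: "(complex^3) set" where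
  "limit_cone = {z. z \<noteq> 0 \<and> herm z z = 0 \<and>
     (\<forall>\<epsilon>>0. \<exists>A\<in>H. \<exists>c. c \<noteq> 0 \<and> dist (c *s (A *v p)) z < \<epsilon>)}"

lemma limit_cone_nonzero: "z \<in> limit_cone \<Longrightarrow> z \<noteq> 0"
  and limit_cone_null: "z \<in> limit_cone \<Longrightarrow> herm z z = 0"
  by (auto simp: limit_cone_def)

lemma limit_coneI:
  assumes "z \<noteq> 0" "herm z z = 0" "\<And>n. A n \<in> H" "\<And>n. c n \<noteq> 0"
    "(\<lambda>n. c n *s (A n *v p)) \<longlonglongrightarrow> z"
  shows "z \<in> limit_cone"
proof -
  have "\<exists>A\<in>H. \<exists>c. c \<noteq> 0 \<and> dist (c *s (A *v p)) z < \<epsilon>" if "\<epsilon> > 0" for \<epsilon>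
  proof -
    have "eventually (\<lambda>n. dist (c n *s (A n *v p)) z < \<epsilon>) sequentially"
      using assms(5) that by (rule tendstoD)
    then obtain n where "dist (c n *s (A n *v p)) z < \<epsilon>"
      using eventually_happens' trivial_limit_sequentially by blast
    then show ?thesis using assms(3,4) by blast
  qed
  then show ?thesis using assms(1,2) by (simp add: limit_cone_def)
qed

text \<open>
  The factors tend to \<open>0\<close> because \<open>herm\<close> of the approximating vectors is \<open>\<bar>c n\<bar>^2 * herm p p\<close>, which tends to
  \<open>herm z z = 0\<close>.
\<close>

lemma limit_coneE:
  assumes "z \<in> limit_cone"
  obtains A c where "\<And>n. A n \<in> H" "\<And>n. c n \<noteq> 0" "(\<lambda>n. c n *s (A n *v p)) \<longlonglongrightarrow> z" "c \<longlonglongrightarrow> 0"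
proof -
  have "\<exists>A. \<exists>c. A \<in> H \<and> c \<noteq> 0 \<and> dist (c *s (A *v p)) z < inverse (real (Suc n))" for n
  proof -
    have "inverse (real (Suc n)) > 0" by simp
    then show ?thesis using assms unfolding limit_cone_def by blast
  qed
  then obtain A c where Ac: "\<And>n. A n \<in> H" "\<And>n. c n \<noteq> 0"
      "\<And>n. dist (c n *s (A n *v p)) z < inverse (real (Suc n))"
    by metis
  have lim: "(\<lambda>n. c n *s (A n *v p)) \<longlonglongrightarrow> z"
    by (rule metric_tendsto_imp_tendsto[OF LIMSEQ_inverse_real_of_nat])
      (use Ac(3) in \<open>auto intro!: always_eventually less_imp_le simp del: of_nat_Suc\<close>)
  have "(\<lambda>n. herm (c n *s (A n *v p)) (c n *s (A n *v p))) \<longlonglongrightarrow> herm z z"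
    by (rule tendsto_herm[OF lim lim])
  then have "(\<lambda>n. c n * cnj (c n) * herm p p) \<longlonglongrightarrow> 0"
    by (simp add: herm_scale U21_herm[OF H_U21[OF Ac(1)]] limit_cone_null[OF assms])
  moreover have "herm p p \<noteq> 0" using p_negative by auto
  ultimately have "(\<lambda>n. c n * cnj (c n)) \<longlonglongrightarrow> 0"
    using tendsto_mult_right_iff[of "herm p p" "\<lambda>n. c n * cnj (c n)" 0] by (simp add: mult.commute)
  then have "(\<lambda>n. sqrt (cmod (c n * cnj (c n)))) \<longlonglongrightarrow> sqrt 0"
    by (intro tendsto_real_sqrt tendsto_norm_zero)
  then have "c \<longlonglongrightarrow> 0"
    by (simp add: norm_mult tendsto_norm_zero_iff)
  then show ?thesis by (rule that[OF Ac(1,2) lim])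
qed

lemma limit_cone_scale:
  assumes "z \<in> limit_cone" "k \<noteq> 0"
  shows "k *s z \<in> limit_cone"
proof -
  obtain A c where Ac: "\<And>n. A n \<in> H" "\<And>n. c n \<noteq> 0" "(\<lambda>n. c n *s (A n *v p)) \<longlonglongrightarrow> z" "c \<longlonglongrightarrow> 0"
    by (rule limit_coneE[OF assms(1)]) (rule that)
  have "(\<lambda>n. (k * c n) *s (A n *v p)) \<longlonglongrightarrow> k *s z"
    using tendsto_scale[OF tendsto_const Ac(3), of k] by simp
  then show ?thesis
    using assms(2) Ac limit_cone_nonzero[OF assms(1)] limit_cone_null[OF assms(1)]
    by (intro limit_coneI[where A = A and c = "\<lambda>n. k * c n"]) (simp_all add: herm_linear)
qed

lemma limit_cone_invariant:
  assumes "z \<in> limit_cone" "B \<in> H"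
  shows "B *v z \<in> limit_cone"
proof -
  obtain A c where Ac: "\<And>n. A n \<in> H" "\<And>n. c n \<noteq> 0" "(\<lambda>n. c n *s (A n *v p)) \<longlonglongrightarrow> z" "c \<longlonglongrightarrow> 0"
    by (rule limit_coneE[OF assms(1)]) (rule that)
  have "(\<lambda>n. c n *s ((B ** A n) *v p)) \<longlonglongrightarrow> B *v z"
    using tendsto_mult_vec[OF tendsto_const Ac(3), of B]
    by (simp add: mult_vec_scale matrix_vector_mul_assoc)
  then show ?thesis
    using Ac limit_cone_nonzero[OF assms(1)] limit_cone_null[OF assms(1)]
    by (intro limit_coneI[where A = "\<lambda>n. B ** A n" and c = c])
      (simp_all add: U21_vec_nonzero U21_herm H_U21 H_mult assms(2))
qed

lemma limit_cone_funpow: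
  assumes "z \<in> limit_cone" "B \<in> H"
  shows "((*v) B ^^ n) z \<in> limit_cone"
  by (induction n) (simp_all add: assms limit_cone_invariant)

lemma H_one: "mat 1 \<in> H"
proof -
  obtain B where "B \<in> H" using H_nonempty by blast
  then show ?thesis
    using H_mult[OF H_inv, of B B] matrix_inv_mult[OF U21_invertible[OF H_U21]] by simp
qed

text \<open>
  The powers of \<open>A\<close> move \<open>p\<close> to \<open>a\<close>; the coordinate of \<open>p\<close> along \<open>a\<close> cannot vanish, as \<open>p\<close> is negative.
\<close>

lemma attracting_in_limit_cone:
  assumes "A \<in> H" and fr: "loxodromic_frame A l u a b c"
  shows "a \<in> limit_cone"
proof -
  note d = loxodromic_frameD[OF fr]
  have pb: "herm p b \<noteq> 0" using null_frame_negative[OF d(1) p_negative] .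
  \<comment> \<open>the powers of \<open>A\<close>, as elements of \<open>H\<close>\<close>
  define P where "P = rec_nat (mat 1) (\<lambda>_. (**) A)"
  have P: "P n \<in> H" "P n *v z = ((*v) A ^^ n) z" for n z
    by (induction n)
      (auto simp: P_def H_one assms(1) intro: H_mult simp flip: matrix_vector_mul_assoc)
  have "(\<lambda>n. ((1 / herm p b) * (1 / l) ^ n) *s (P n *v p)) \<longlonglongrightarrow> (1 / herm p b) *s (herm p b *s a)"
    using tendsto_scale[OF tendsto_const loxodromic_power_converges[OF fr, of p], of "1 / herm p b"]
    by (simp add: P(2))
  then show ?thesis
    using pb P d(7) null_frameD[OF d(1)]
    by (intro limit_coneI[where A = P and c = "\<lambda>n. (1 / herm p b) * (1 / l) ^ n"]) auto
qed


text \<open>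
  Without scaling of \<open>\<xi>\<close>, the group preserves the horospheres at \<open>\<xi>\<close>, the level sets of
  \<open>\<bar>herm z \<xi>\<bar>\<^sup>2 / \<bar>herm z z\<bar>\<close>. An orbit stays on one of them, and a horosphere meets the boundary in its
  centre only.
\<close>

lemma limit_cone_fixed_direction:
  assumes "herm \<xi> \<xi> = 0" "\<xi> \<noteq> 0"
    and fix_\<xi>: "\<And>A. A \<in> H \<Longrightarrow> \<exists>k. cmod k = 1 \<and> A *v \<xi> = k *s \<xi>"
    and "z \<in> limit_cone"
  obtains k where "z = k *s \<xi>"
proof -
  obtain A c where Ac: "\<And>n. A n \<in> H" "\<And>n. c n \<noteq> 0" "(\<lambda>n. c n *s (A n *v p)) \<longlonglongrightarrow> z" "c \<longlonglongrightarrow> 0"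
    by (rule limit_coneE[OF assms(4)]) (rule that)
  have "cmod (herm (c n *s (A n *v p)) \<xi>) = cmod (c n) * cmod (herm p \<xi>)" for n
  proof -
    obtain k where "cmod k = 1" "matrix_inv (A n) *v \<xi> = k *s \<xi>"
      using fix_\<xi>[OF H_inv[OF Ac(1)]] by blast
    then show ?thesis
      by (simp add: herm_linear U21_herm_inv[OF H_U21[OF Ac(1)]] norm_mult)
  qed
  moreover have "(\<lambda>n. cmod (herm (c n *s (A n *v p)) \<xi>)) \<longlonglongrightarrow> cmod (herm z \<xi>)"
    by (intro tendsto_norm tendsto_herm Ac(3) tendsto_const)
  moreover have "(\<lambda>n. cmod (c n) * cmod (herm p \<xi>)) \<longlonglongrightarrow> 0"
    by (intro tendsto_mult_left_zero tendsto_norm_zero Ac(4))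
  ultimately have "herm z \<xi> = 0"
    using LIMSEQ_unique by fastforce
  then show ?thesis
    using null_orthogonal_proportional[of \<xi> z] assms(1,2) limit_cone_null[OF assms(4)] that
    by (metis herm_eq_0_swap)
qed

text \<open>
  The function \<open>\<bar>herm z a * herm z b\<bar> / \<bar>herm z z\<bar>\<close> measures the distance to the geodesic between \<open>a\<close> and \<open>b\<close>.
  It is invariant under matrices that preserve the pair of lines, also when they exchange them, so
  at a limit point the numerator vanishes.
\<close>

lemma limit_cone_invariant_pair:
  assumes null: "herm a a = 0" "herm b b = 0" and ab: "herm a b = 1"
    and a_pair: "\<And>A. A \<in> H \<Longrightarrow> \<exists>k. A *v a = k *s a \<or> A *v a = k *s b"
    and b_pair: "\<And>A. A \<in> H \<Longrightarrow> \<exists>k. A *v b = k *s a \<or> A *v b = k *s b"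
    and "z \<in> limit_cone"
  obtains k where "z = k *s a \<or> z = k *s b"
proof -
  obtain A c where Ac: "\<And>n. A n \<in> H" "\<And>n. c n \<noteq> 0" "(\<lambda>n. c n *s (A n *v p)) \<longlonglongrightarrow> z" "c \<longlonglongrightarrow> 0"
    by (rule limit_coneE[OF assms(6)]) (rule that)
  have "herm b a = 1" using ab herm_cnj[of a b] by simp
  note ab = ab this
  let ?F = "\<lambda>z. herm z a * herm z b"
  have "cmod (?F (c n *s (A n *v p))) = (cmod (c n))\<^sup>2 * cmod (?F p)" for n
  proof -
    let ?B = "matrix_inv (A n)"
    have B: "?B \<in> H" using H_inv[OF Ac(1)] .
    obtain k where k: "?B *v a = k *s a \<or> ?B *v a = k *s b"
      using a_pair[OF B] by blast
    obtain m where m: "?B *v b = m *s a \<or> ?B *v b = m *s b"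
      using b_pair[OF B] by blast
    have *: "herm (?B *v a) (?B *v b) = 1" using U21_herm[OF H_U21[OF B]] ab by simp
    then have "?B *v a = k *s a \<and> ?B *v b = m *s b \<or> ?B *v a = k *s b \<and> ?B *v b = m *s a"
      using k m null by (auto simp: herm_linear)
    note cases = this
    then have "herm (k *s a) (m *s b) = 1 \<or> herm (k *s b) (m *s a) = 1" using * by auto
    then have "k * cnj m = 1" using ab by (simp add: herm_scale)
    then have km: "cmod k * cmod m = 1" by (metis complex_mod_cnj norm_mult norm_one)
    have "cmod (herm p (?B *v a) * herm p (?B *v b)) = (cmod k * cmod m) * cmod (?F p)"
      using cases by (auto simp: herm_linear norm_mult)
    then have "cmod (herm p (?B *v a) * herm p (?B *v b)) = cmod (?F p)"
      unfolding km by simp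
    then show ?thesis
      by (simp add: herm_linear U21_herm_inv[OF H_U21[OF Ac(1)]] norm_mult power2_eq_square)
  qed
  moreover have "(\<lambda>n. cmod (?F (c n *s (A n *v p)))) \<longlonglongrightarrow> cmod (?F z)"
    by (intro tendsto_norm tendsto_mult tendsto_herm Ac(3) tendsto_const)
  moreover have "(\<lambda>n. (cmod (c n))\<^sup>2 * cmod (?F p)) \<longlonglongrightarrow> 0"
    using Ac(4) by (auto intro!: tendsto_eq_intros)
  ultimately have "?F z = 0"
    using LIMSEQ_unique by fastforce
  then have "herm a z = 0 \<or> herm b z = 0" using herm_eq_0_swap by auto
  then show ?thesis
    using null_orthogonal_proportional[of a z] null_orthogonal_proportional[of b z] null ab
      limit_cone_null[OF assms(6)] that by (metis herm_zero zero_neq_one)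
qed

end

section \<open>Existence of expanding eigenvalues\<close>

text \<open>
  The conjugate transpose of \<open>A\<close>, with signs adapted to the form. On \<open>U21\<close> it agrees with the inverse, but
  it is continuous on all matrices.
\<close>

definition herm_adjoint :: "complex^3^3 \<Rightarrow> complex^3^3" where
  "herm_adjoint A = (\<chi> i j. (if (i = 3) = (j = 3) then 1 else -1) * cnj (A$j$i))"

lemma herm_adjoint: "herm (A *v x) y = herm x (herm_adjoint A *v y)"
  by (simp add: herm_def herm_adjoint_def matrix_vector_mult_def sum_3 algebra_simps)

lemma U21_herm_adjoint:
  assumes "A \<in> U21"
  shows "herm (herm_adjoint A *v x) (herm_adjoint A *v y) = herm x y"
proof -
  have "herm z (matrix_inv A *v y - herm_adjoint A *v y) = 0" for z y
    using herm_adjoint[of A z y] U21_herm_inv[OF assms, of z y] by (simp add: herm_linear)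
  then have "herm_adjoint A *v y = matrix_inv A *v y" for y
    using herm_nondegenerate by (metis eq_iff_diff_eq_0)
  then show ?thesis by (simp add: U21_herm[OF U21_inv[OF assms]])
qed

lemma scaleR_mult_vec: "(r *\<^sub>R A) *v x = of_real r *s (A *v x)" for A :: "complex^3^3"
  by (simp add: vec_eq_iff matrix_vector_mult_def sum_3 scaleR_conv_of_real[where 'a = complex] algebra_simps)

lemma herm_adjoint_scaleR: "herm_adjoint (r *\<^sub>R A) = r *\<^sub>R herm_adjoint A"
  by (simp add: vec_eq_iff herm_adjoint_def)

lemma tendsto_herm_adjoint:
  assumes "(A \<longlongrightarrow> A') F"
  shows "((\<lambda>x. herm_adjoint (A x)) \<longlongrightarrow> herm_adjoint A') F"
  unfolding herm_adjoint_def
  by (intro vec_tendstoI) (auto intro!: tendsto_mult tendsto_const tendsto_cnj tendsto_vec_nth assms)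

lemma norm_vec_scale: "norm (c *s z) = cmod c * norm z" for z :: "complex^3"
  by (simp add: norm_vec_def L2_set_def norm_mult power_mult_distrib real_sqrt_mult
      flip: sum_distrib_left)

lemma mult_vec_norm_bound:
  fixes z :: "complex^3"
  obtains K where "\<And>A :: complex^3^3. norm (A *v z) \<le> norm A * K"
proof -
  have "linear (\<lambda>A :: complex^3^3. A *v z)"
    by (rule linearI) (simp_all add: matrix_vector_mult_add_rdistrib scaleR_mult_vec
        vec_eq_iff scaleR_conv_of_real[where 'a = complex])
  then show ?thesis
    using that bounded_linear.bounded linear_conv_bounded_linear by metis
qed

text \<open>
  If unitary matrices go to infinity, rescaling them to bounded size makes the form of their values
  collapse. Together with \<open>null_orthogonal_proportional\<close> this forces the limit to have rank at most one.
\<close>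

lemma rescaled_limit_isotropic:
  assumes A: "\<And>n. A n \<in> U21" and r: "r \<longlonglongrightarrow> 0" and B: "(\<lambda>n. r n *\<^sub>R A n) \<longlonglongrightarrow> B"
  shows "herm (B *v x) (B *v y) = 0" "herm (herm_adjoint B *v x) (herm_adjoint B *v y) = 0"
proof -
  have r2: "(\<lambda>n. of_real (r n) * of_real (r n) * herm x y) \<longlonglongrightarrow> 0"
    using tendsto_of_real[OF r, where 'a = complex] by (intro tendsto_mult_left_zero tendsto_mult_zero) simp_all
  have "(\<lambda>n. herm ((r n *\<^sub>R A n) *v x) ((r n *\<^sub>R A n) *v y)) \<longlonglongrightarrow> herm (B *v x) (B *v y)"
    by (intro tendsto_herm tendsto_mult_vec B tendsto_const)
  then have "(\<lambda>n. of_real (r n) * of_real (r n) * herm x y) \<longlonglongrightarrow> herm (B *v x) (B *v y)"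
    by (simp add: scaleR_mult_vec herm_scale U21_herm[OF A])
  then show "herm (B *v x) (B *v y) = 0" using r2 LIMSEQ_unique by blast
  have "(\<lambda>n. herm (herm_adjoint (r n *\<^sub>R A n) *v x) (herm_adjoint (r n *\<^sub>R A n) *v y))
      \<longlonglongrightarrow> herm (herm_adjoint B *v x) (herm_adjoint B *v y)"
    by (intro tendsto_herm tendsto_mult_vec tendsto_herm_adjoint B tendsto_const)
  then have "(\<lambda>n. of_real (r n) * of_real (r n) * herm x y)
      \<longlonglongrightarrow> herm (herm_adjoint B *v x) (herm_adjoint B *v y)"
    by (simp add: herm_adjoint_scaleR scaleR_mult_vec herm_scale U21_herm_adjoint[OF A])
  then show "herm (herm_adjoint B *v x) (herm_adjoint B *v y) = 0" using r2 LIMSEQ_unique by blast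
qed

lemma rank_one_trace:
  fixes B C :: "complex^3^3"
  assumes "\<And>y. B *v y = f y *s \<xi>"
  shows "B *v (C *v \<xi>) = trace (C ** B) *s \<xi>"
proof -
  have "B$i$j = f (axis j 1) * \<xi>$i" for i j
    using arg_cong[OF assms[of "axis j 1"], of "\<lambda>v. v$i"]
    by (simp add: matrix_vector_mult_def axis_def if_distrib cong: if_cong)
  then show ?thesis
    by (simp add: vec_eq_iff matrix_vector_mult_def matrix_matrix_mult_def trace_def sum_3 forall_3
        algebra_simps)
qed

context unitary_orbit
begin

text \<open>
  If no eigenvalue is expanding, the traces of \<open>H\<close> are bounded. Take \<open>A n\<close> in \<open>H\<close> that move \<open>p\<close> to \<open>x\<close>, and a
  limit \<open>B\<close> of their rescalings; it has rank one with null range \<open>\<xi>\<close>, and its kernel is the orthogonal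
  complement of a null vector \<open>\<eta>\<close>. Bounded traces of \<open>C ** A n\<close> give \<open>trace (C ** B) = 0\<close>, that is
  \<open>herm (C *v \<xi>) \<eta> = 0\<close>. Two orthogonal null vectors are proportional, so every \<open>C\<close> in \<open>H\<close> maps \<open>\<xi>\<close> into the
  line of \<open>\<eta>\<close>, and the group fixes this line.
\<close>

lemma exists_expanding:
  assumes x: "x \<in> limit_cone" and y: "y \<in> limit_cone" and xy: "\<And>k. y \<noteq> k *s x"
  obtains A l a where "A \<in> H" "a \<noteq> 0" "A *v a = l *s a" "cmod l > 1"
proof (rule ccontr)
  assume "\<not> thesis"
  then have ev: "cmod l \<le> 1" if "A \<in> H" "a \<noteq> 0" "A *v a = l *s a" for A l a
    using that \<open>\<And>A l a. \<lbrakk>A \<in> H; a \<noteq> 0; A *v a = l *s a; 1 < cmod l\<rbrakk> \<Longrightarrow> thesis\<close> by (meson not_le)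
  then have tr: "cmod (trace A) \<le> 3" if "A \<in> H" for A
    using trace_bounded_by_eigenvalues that by blast
  obtain A c where Ac: "\<And>n. A n \<in> H" "\<And>n. c n \<noteq> 0" "(\<lambda>n. c n *s (A n *v p)) \<longlonglongrightarrow> x" "c \<longlonglongrightarrow> 0"
    by (rule limit_coneE[OF x]) (rule that)
  define r where "r n = 1 / norm (A n)" for n
  have A0: "norm (A n) > 0" for n
  proof -
    have "A n *v x \<noteq> 0" using U21_vec_nonzero H_U21 Ac(1) limit_cone_nonzero[OF x] by blast
    then show ?thesis by auto
  qed
  \<comment> \<open>\<open>c n *s (A n *v p)\<close> stays away from \<open>0\<close> while \<open>c n\<close> tends to \<open>0\<close>, so the norm of \<open>A n\<close> is unbounded\<close>
  have "r \<longlonglongrightarrow> 0"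
  proof -
    obtain K where K: "\<And>A :: complex^3^3. norm (A *v p) \<le> norm A * K" by (rule mult_vec_norm_bound[where z = p]) (rule that)
    have "norm (r n * norm (c n *s (A n *v p))) \<le> cmod (c n) * K" for n
      using mult_left_mono[OF K[of "A n"], of "cmod (c n)"] A0[of n]
      by (simp add: r_def divide_le_eq norm_vec_scale mult.commute mult.left_commute)
    then have "(\<lambda>n. r n * norm (c n *s (A n *v p))) \<longlonglongrightarrow> 0"
      by (intro tendsto_0_le[OF Ac(4), of _ K] always_eventually) simp
    moreover have n: "(\<lambda>n. norm (c n *s (A n *v p))) \<longlonglongrightarrow> norm x" by (intro tendsto_norm Ac(3))
    ultimately have "(\<lambda>n. (r n * norm (c n *s (A n *v p))) / norm (c n *s (A n *v p))) \<longlonglongrightarrow> 0 / norm x"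
      using limit_cone_nonzero[OF x] by (intro tendsto_divide) auto
    moreover have "c n *s (A n *v p) \<noteq> 0" for n
    proof -
      have "p \<noteq> 0" using p_negative by auto
      then show ?thesis using Ac(2)[of n] U21_vec_nonzero[OF H_U21[OF Ac(1)]] by simp
    qed
    ultimately show ?thesis by simp
  qed
  have "norm (A n) \<noteq> 0" for n using A0[of n] by simp
  then have sphere: "\<forall>n. r n *\<^sub>R A n \<in> sphere 0 1" by (simp add: r_def)
  have "compact (sphere (0 :: complex^3^3) 1)" by simp
  then obtain B s where B1: "B \<in> sphere 0 1" and s: "strict_mono s"
      and lim: "((\<lambda>n. r n *\<^sub>R A n) \<circ> s) \<longlonglongrightarrow> B"
    unfolding compact_def using sphere by meson
  define A' where "A' = A \<circ> s"
  define r' where "r' = r \<circ> s"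
  have A': "A' n \<in> H" for n by (simp add: A'_def Ac(1))
  have r': "r' \<longlonglongrightarrow> 0" unfolding r'_def by (rule LIMSEQ_subseq_LIMSEQ[OF \<open>r \<longlonglongrightarrow> 0\<close> s])
  have lim': "(\<lambda>n. r' n *\<^sub>R A' n) \<longlonglongrightarrow> B" using lim by (simp add: A'_def r'_def o_def)
  note iso = rescaled_limit_isotropic[OF H_U21[OF A'] r' lim']
  obtain x0 where x0: "B *v x0 \<noteq> 0"
    using B1 matrix_eq[of B 0] by auto
  define \<xi> where "\<xi> = B *v x0"
  obtain y0 where y0: "herm_adjoint B *v y0 \<noteq> 0"
  proof -
    obtain y where "herm y (B *v x0) \<noteq> 0" using herm_nondegenerate x0 by blast
    then have "herm x0 (herm_adjoint B *v y) \<noteq> 0"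
      using herm_adjoint herm_eq_0_swap by metis
    then show ?thesis using that by fastforce
  qed
  define \<eta> where "\<eta> = herm_adjoint B *v y0"
  have \<xi>: "herm \<xi> \<xi> = 0" "\<xi> \<noteq> 0" and \<eta>: "herm \<eta> \<eta> = 0" "\<eta> \<noteq> 0"
    using iso x0 y0 by (auto simp: \<xi>_def \<eta>_def)
  have "\<exists>k. B *v w = k *s \<xi>" for w
    using null_orthogonal_proportional[of \<xi> "B *v w"] \<xi> iso unfolding \<xi>_def by metis
  then obtain f where f: "\<And>w. B *v w = f w *s \<xi>" by metis
  have B_orbit: "B *v (C *v \<xi>) = 0" if C: "C \<in> H" for C
  proof -
    have "cmod (trace (C ** (r' n *\<^sub>R A' n))) \<le> cmod (of_real (r' n)) * 3" for n
    proof -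
      have "trace (C ** (r' n *\<^sub>R A' n)) = of_real (r' n) * trace (C ** A' n)"
        by (simp add: trace_def matrix_matrix_mult_def sum_3 scaleR_conv_of_real[where 'a = complex] algebra_simps)
      then show ?thesis
        using mult_left_mono[OF tr[OF H_mult[OF C A'[of n]]], of "\<bar>r' n\<bar>"] by (simp add: norm_mult)
    qed
    then have "(\<lambda>n. trace (C ** (r' n *\<^sub>R A' n))) \<longlonglongrightarrow> 0"
      by (intro tendsto_0_le[OF tendsto_of_real[OF r', where 'a = complex, unfolded of_real_0], of _ 3]
          always_eventually) simp
    moreover have "(\<lambda>n. trace (C ** (r' n *\<^sub>R A' n))) \<longlonglongrightarrow> trace (C ** B)"
      unfolding trace_def matrix_matrix_mult_def
      by (simp del: vector_scaleR_component)
        (intro tendsto_sum tendsto_mult tendsto_const tendsto_vec_nth lim')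
    ultimately have "trace (C ** B) = 0" using LIMSEQ_unique by blast
    then show ?thesis using rank_one_trace[OF f, of C] by simp
  qed
  have "\<exists>k. C *v \<xi> = k *s \<eta>" if C: "C \<in> H" for C
  proof -
    have "herm (C *v \<xi>) \<eta> = 0"
      using B_orbit[OF C] herm_adjoint[of B "C *v \<xi>" y0] by (simp add: \<eta>_def)
    moreover have "herm (C *v \<xi>) (C *v \<xi>) = 0" using \<xi> U21_herm[OF H_U21[OF C]] by simp
    ultimately show ?thesis
      using null_orthogonal_proportional[of \<eta> "C *v \<xi>"] \<eta> by (metis herm_eq_0_swap)
  qed
  note to_\<eta> = this
  obtain k1 where k1: "\<xi> = k1 *s \<eta>" using to_\<eta>[OF H_one] by auto
  have k10: "k1 \<noteq> 0" using k1 \<xi> by auto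
  \<comment> \<open>the eigenvalue and its inverse, which belongs to the inverse matrix, both lie in the unit disc\<close>
  have fix_\<xi>: "\<exists>k. cmod k = 1 \<and> C *v \<xi> = k *s \<xi>" if C: "C \<in> H" for C
  proof -
    obtain k where "C *v \<xi> = k *s \<eta>" using to_\<eta>[OF C] by blast
    then have k: "C *v \<xi> = (k / k1) *s \<xi>" using k1 k10 by simp
    then have "k / k1 \<noteq> 0" using U21_vec_nonzero[OF H_U21[OF C] \<xi>(2)] by auto
    then have "cmod (1 / (k / k1)) \<le> 1"
      using ev[OF H_inv[OF C] \<xi>(2)] U21_inv_eigenvector[OF H_U21[OF C] k] by blast
    moreover have "cmod (k / k1) \<le> 1" using ev[OF C \<xi>(2) k] .
    ultimately have "cmod (k / k1) = 1"
      using \<open>k / k1 \<noteq> 0\<close> by (simp add: norm_divide divide_le_eq split: if_splits)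
    with k show ?thesis by blast
  qed
  obtain k where k: "x = k *s \<xi>" using limit_cone_fixed_direction[OF \<xi> fix_\<xi> x] by blast
  obtain m where m: "y = m *s \<xi>" using limit_cone_fixed_direction[OF \<xi> fix_\<xi> y] by blast
  have "k \<noteq> 0" using k limit_cone_nonzero[OF x] by auto
  then have "y = (m / k) *s x" by (simp add: k m)
  then show False using xy by blast
qed

end

section \<open>Curves and difference quotients\<close>

lemma has_vector_derivative_complex_quotient:
  fixes f :: "real \<Rightarrow> complex"
  assumes "(f has_vector_derivative d) (at t0)" "f t0 = 0"
  shows "((\<lambda>t. f t / of_real (t - t0)) \<longlongrightarrow> d) (at t0)"
proof -
  have "((\<lambda>t. Re (f t)) has_real_derivative Re d) (at t0)"
    "((\<lambda>t. Im (f t)) has_real_derivative Im d) (at t0)"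
    using bounded_linear.has_vector_derivative[OF bounded_linear_Re assms(1)]
      bounded_linear.has_vector_derivative[OF bounded_linear_Im assms(1)]
    by (simp_all add: has_real_derivative_iff_has_vector_derivative)
  then have "((\<lambda>t. Re (f t) / (t - t0)) \<longlongrightarrow> Re d) (at t0)"
    "((\<lambda>t. Im (f t) / (t - t0)) \<longlongrightarrow> Im d) (at t0)"
    using assms(2) by (simp_all add: has_field_derivative_iff)
  then show ?thesis by (simp add: tendsto_complex_iff del: of_real_diff)
qed

lemma second_order_quotient_real:
  fixes f f' :: "real \<Rightarrow> real"
  assumes "\<And>t. (f has_real_derivative f' t) (at t)" "(f' has_real_derivative d) (at t0)"
    "f t0 = 0" "f' t0 = 0"
  shows "((\<lambda>t. f t / (t - t0)\<^sup>2) \<longlongrightarrow> d / 2) (at t0)"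
proof (rule lhopital[where f' = f' and g' = "\<lambda>t. 2 * (t - t0)"])
  have "(f \<longlongrightarrow> f t0) (at t0)"
    using DERIV_isCont[OF assms(1)] by (simp add: isCont_def)
  then show "(f \<longlongrightarrow> 0) (at t0)" using assms(3) by simp
  show "((\<lambda>t. (t - t0)\<^sup>2) \<longlongrightarrow> 0) (at t0)" by (auto intro!: tendsto_eq_intros)
  show "\<forall>\<^sub>F t in at t0. (t - t0)\<^sup>2 \<noteq> 0" "\<forall>\<^sub>F t in at t0. 2 * (t - t0) \<noteq> 0"
    by (auto simp: eventually_at_filter)
  show "\<forall>\<^sub>F t in at t0. (f has_real_derivative f' t) (at t)" using assms(1) by simp
  show "\<forall>\<^sub>F t in at t0. ((\<lambda>t. (t - t0)\<^sup>2) has_real_derivative 2 * (t - t0)) (at t)"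
    by (intro always_eventually allI) (auto intro!: derivative_eq_intros)
  have "((\<lambda>t. f' t / (t - t0)) \<longlongrightarrow> d) (at t0)"
    using assms(2,4) by (simp add: has_field_derivative_iff)
  from tendsto_divide[OF this tendsto_const[of 2]]
  show "((\<lambda>t. f' t / (2 * (t - t0))) \<longlongrightarrow> d / 2) (at t0)"
    by (simp add: mult.commute)
qed

lemma second_order_quotient:
  fixes f f' :: "real \<Rightarrow> complex"
  assumes "\<And>t. (f has_vector_derivative f' t) (at t)" "(f' has_vector_derivative d) (at t0)"
    "f t0 = 0" "f' t0 = 0"
  shows "((\<lambda>t. f t / (of_real (t - t0))\<^sup>2) \<longlongrightarrow> d / 2) (at t0)"
proof -
  note Re = bounded_linear.has_vector_derivative[OF bounded_linear_Re]
  note Im = bounded_linear.has_vector_derivative[OF bounded_linear_Im]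
  have "((\<lambda>t. Re (f t) / (t - t0)\<^sup>2) \<longlongrightarrow> Re d / 2) (at t0)"
    using Re[OF assms(1)] Re[OF assms(2)] assms(3,4)
    by (intro second_order_quotient_real[where f' = "\<lambda>t. Re (f' t)"])
      (simp_all add: has_real_derivative_iff_has_vector_derivative)
  moreover have "((\<lambda>t. Im (f t) / (t - t0)\<^sup>2) \<longlongrightarrow> Im d / 2) (at t0)"
    using Im[OF assms(1)] Im[OF assms(2)] assms(3,4)
    by (intro second_order_quotient_real[where f' = "\<lambda>t. Im (f' t)"])
      (simp_all add: has_real_derivative_iff_has_vector_derivative)
  ultimately show ?thesis
    by (simp add: tendsto_complex_iff flip: of_real_diff of_real_power)
qed

text \<open>
  A nonzero derivative makes \<open>g\<close> change sign at \<open>t0\<close>, and the intermediate value theorem gives all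
  values in between.
\<close>

lemma covers_neighbourhood:
  fixes g :: "real \<Rightarrow> real"
  assumes "\<eta> > 0" and cont: "continuous_on {t0 - \<eta>..t0 + \<eta>} g" and "g t0 = 0"
    and der: "(g has_real_derivative d) (at t0)" and "d \<noteq> 0"
  obtains \<epsilon> where "\<epsilon> > 0" "\<And>y. \<bar>y\<bar> < \<epsilon> \<Longrightarrow> \<exists>t\<in>{t0 - \<eta>..t0 + \<eta>}. g t = y"
proof -
  have *: "\<exists>\<epsilon>>0. \<forall>y. \<bar>y\<bar> < \<epsilon> \<longrightarrow> (\<exists>t\<in>{t0 - \<eta>..t0 + \<eta>}. h t = y)"
    if cont: "continuous_on {t0 - \<eta>..t0 + \<eta>} h" and "h t0 = 0"
      and der: "(h has_real_derivative d) (at t0)" and "d > 0" for h :: "real \<Rightarrow> real" and d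
  proof -
    obtain e1 where e1: "e1 > 0" "\<And>x. x > 0 \<Longrightarrow> x < e1 \<Longrightarrow> h t0 < h (t0 + x)"
      using DERIV_pos_inc_right[OF der \<open>d > 0\<close>] by blast
    obtain e2 where e2: "e2 > 0" "\<And>x. x > 0 \<Longrightarrow> x < e2 \<Longrightarrow> h (t0 - x) < h t0"
      using DERIV_pos_inc_left[OF der \<open>d > 0\<close>] by blast
    define x where "x = min (min e1 e2) \<eta> / 2"
    have x: "0 < x" "x < e1" "x < e2" "x \<le> \<eta>" using e1 e2 \<open>\<eta> > 0\<close> by (auto simp: x_def)
    have pos: "h (t0 + x) > 0" and neg: "h (t0 - x) < 0" using e1 e2 x \<open>h t0 = 0\<close> by metis+
    have sub: "continuous_on {t0 - x..t0 + x} h" by (rule continuous_on_subset[OF cont]) (use x in auto)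
    have "\<exists>t\<in>{t0 - \<eta>..t0 + \<eta>}. h t = y" if "\<bar>y\<bar> < min (h (t0 + x)) (- h (t0 - x))" for y
    proof -
      have "\<exists>t. t0 - x \<le> t \<and> t \<le> t0 + x \<and> h t = y"
        by (rule IVT') (use that x sub in auto)
      then show ?thesis using x by force
    qed
    then show ?thesis using pos neg by (intro exI[of _ "min (h (t0 + x)) (- h (t0 - x))"]) auto
  qed
  show ?thesis
  proof (cases "d > 0")
    case True
    then show ?thesis using *[OF cont \<open>g t0 = 0\<close> der] that by blast
  next
    case False
    then have "continuous_on {t0 - \<eta>..t0 + \<eta>} (\<lambda>t. - g t)" "- d > 0"
      using cont \<open>d \<noteq> 0\<close> by (auto intro: continuous_on_minus)
    then obtain \<epsilon> where \<epsilon>: "\<epsilon> > 0" "\<And>y. \<bar>y\<bar> < \<epsilon> \<Longrightarrow> \<exists>t\<in>{t0 - \<eta>..t0 + \<eta>}. - g t = y"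
      using *[of "\<lambda>t. - g t" "- d"] DERIV_minus[OF der] \<open>g t0 = 0\<close> by auto
    have "\<exists>t\<in>{t0 - \<eta>..t0 + \<eta>}. g t = y" if "\<bar>y\<bar> < \<epsilon>" for y
      using \<epsilon>(2)[of "- y"] that by auto
    then show ?thesis using that \<epsilon>(1) by blast
  qed
qed

lemma bounded_linear_herm_left: "bounded_linear (\<lambda>z. herm z v)"
  by (auto simp: linear_conv_bounded_linear[symmetric] herm_def algebra_simps scaleR_conv_of_real[where 'a = complex]
      intro!: linearI)

lemma power_mult_convergent_imp_zero:
  fixes z w :: complex
  assumes "cmod z > 1" and lim: "(\<lambda>n. z ^ n * w) \<longlonglongrightarrow> L"
  shows "w = 0"
proof (rule ccontr)
  assume "w \<noteq> 0"
  then have "(\<lambda>n. z ^ n) \<longlonglongrightarrow> L / w"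
    using tendsto_divide[OF lim tendsto_const[of w]] by simp
  moreover have "filterlim (\<lambda>n. z ^ n) at_infinity sequentially"
    by (rule filterlim_realpow_sequentially_gt1[OF assms(1)])
  ultimately show False
    using not_tendsto_and_filterlim_at_infinity trivial_limit_sequentially by blast
qed

text \<open>
  Convergence of \<open>v ^ n * w\<close> is stable under the shift of \<open>n\<close>, so its nonzero limit is fixed by multiplication
  with \<open>v\<close>.
\<close>

lemma unit_power_mult_limit:
  fixes v w :: complex
  assumes "cmod v = 1" "w \<noteq> 0" and lim: "(\<lambda>n. v ^ n * w) \<longlonglongrightarrow> L"
  shows "v = 1" "w = L"
proof -
  have "(\<lambda>n. cmod (v ^ n * w)) \<longlonglongrightarrow> cmod L" by (rule tendsto_norm[OF lim])
  then have "cmod w = cmod L"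
    using assms(1) by (simp add: norm_mult norm_power LIMSEQ_const_iff)
  then have "L \<noteq> 0" using assms(2) by auto
  have "(\<lambda>n. v * (v ^ n * w)) \<longlonglongrightarrow> v * L" by (intro tendsto_mult tendsto_const lim)
  moreover have "(\<lambda>n. v * (v ^ n * w)) \<longlonglongrightarrow> L" using LIMSEQ_Suc[OF lim] by (simp add: mult.assoc)
  ultimately have "v * L = L" using LIMSEQ_unique by blast
  then show "v = 1" using \<open>L \<noteq> 0\<close> by simp
  with lim show "w = L" by (simp add: LIMSEQ_const_iff)
qed

lemma null_frame_null_cases:
  assumes fr: "null_frame a b c" and "herm z z = 0"
  shows "herm z a = 0 \<Longrightarrow> z = herm z b *s a" "herm z b = 0 \<Longrightarrow> z = herm z a *s b"
    "2 * Re (herm z b * cnj (herm z a)) + (cmod (herm z c))\<^sup>2 = 0"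
proof -
  show *: "2 * Re (herm z b * cnj (herm z a)) + (cmod (herm z c))\<^sup>2 = 0"
    using null_frame_Re_herm_self[OF fr, of z] assms(2) by simp
  show "z = herm z b *s a" if "herm z a = 0"
  proof -
    have "herm z c = 0" using * that by simp
    then show ?thesis using null_frame_expand[OF fr, of z] that by simp
  qed
  show "z = herm z a *s b" if "herm z b = 0"
  proof -
    have "herm z c = 0" using * that by simp
    then show ?thesis using null_frame_expand[OF fr, of z] that by simp
  qed
qed

section \<open>Dynamics on an invariant knot\<close>

lemma small_cis_eq_1:
  assumes "cis d = 1" "\<bar>d\<bar> \<le> pi"
  shows "d = 0"
proof -
  have "cos d = 1" using assms(1) by (metis cis.sel(1) one_complex.sel(1))
  then obtain n :: int where n: "d = of_int n * 2 * pi" using cos_one_2pi_int by blast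
  have "\<bar>real_of_int n\<bar> * (2 * pi) \<le> pi" using assms(2) n by (simp add: abs_mult)
  then have "\<bar>real_of_int n\<bar> * 2 \<le> 1" using pi_gt_zero by (simp add: mult.assoc[symmetric])
  then have "n = 0" by linarith
  with n show ?thesis by simp
qed

text \<open>
  The knot in homogeneous coordinates, normalised by \<open>W_third\<close>; \<open>W1\<close> and \<open>W2\<close> are its first two derivatives. The
  knot is tangent to the contact plane at \<open>t\<close> exactly if \<open>herm (W1 t) (W t) = 0\<close>.
\<close>

locale invariant_knot = unitary_orbit +
  fixes W W1 W2 :: "real \<Rightarrow> complex^3"
  assumes W_deriv: "(W has_vector_derivative W1 t) (at t)"
    and W1_deriv: "(W1 has_vector_derivative W2 t) (at t)"
    and W1_nonzero: "W1 t \<noteq> 0"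
    and W_third: "W t $ 3 = 1"
    and W_eq_iff: "W s = W t \<longleftrightarrow> cis s = cis t"
    and limit_cone_iff: "z \<in> limit_cone \<longleftrightarrow> (\<exists>k t. k \<noteq> 0 \<and> z = k *s W t)"
begin

lemma W_in_limit_cone: "W t \<in> limit_cone"
  using limit_cone_iff[of "W t"] by (metis vec.scale_one zero_neq_one)

lemma W_null: "herm (W t) (W t) = 0"
  using limit_cone_null W_in_limit_cone by blast

lemma W_nonzero: "W t \<noteq> 0"
  using limit_cone_nonzero W_in_limit_cone by blast

lemma W_coordinate_deriv:
  "((\<lambda>t. herm (W t) v) has_vector_derivative herm (W1 t) v) (at t)"
  "((\<lambda>t. herm (W1 t) v) has_vector_derivative herm (W2 t) v) (at t)"
  by (rule bounded_linear.has_vector_derivative[OF bounded_linear_herm_left W_deriv]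
      bounded_linear.has_vector_derivative[OF bounded_linear_herm_left W1_deriv])+

lemma W_continuous: "continuous_on S W"
  using has_vector_derivative_continuous[OF W_deriv] continuous_at_imp_continuous_on by blast

lemma W1_third: "W1 t $ 3 = 0"
proof -
  have "((\<lambda>t. herm (W t) (axis 3 1)) has_vector_derivative herm (W1 t) (axis 3 1)) (at t)"
    by (rule W_coordinate_deriv)
  then have "((\<lambda>t. - 1) has_vector_derivative - (W1 t $ 3)) (at t)"
    by (simp add: herm_def axis_def W_third)
  moreover have "((\<lambda>t. - 1 :: complex) has_vector_derivative 0) (at t)" by simp
  ultimately show ?thesis using vector_derivative_unique_at by fastforce
qed

text \<open>
  The last coordinate of \<open>W\<close> is constant, so that of \<open>W1\<close> vanishes and \<open>k\<close> could only be \<open>0\<close>. Hence the knot is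
  regular also as a curve in the projective plane.
\<close>

lemma W1_not_parallel: "W1 t \<noteq> k *s W t"
proof
  assume eq: "W1 t = k *s W t"
  have "W1 t $ 3 = (k *s W t) $ 3" unfolding eq[symmetric] ..
  then have "k = 0" by (simp add: W1_third W_third)
  with eq show False using W1_nonzero by simp
qed

text \<open>
  The curve is a homeomorphism onto its image: outside a neighbourhood of \<open>t0\<close>, the compact interval
  is mapped to a compact set that misses \<open>W t0\<close>.
\<close>

lemma parameters_converge:
  assumes lim: "(\<lambda>n. W (s n)) \<longlonglongrightarrow> W t0" and near: "\<And>n. \<bar>s n - t0\<bar> \<le> pi"
  shows "s \<longlonglongrightarrow> t0"
proof (rule tendstoI)
  fix \<eta> :: real assume "\<eta> > 0"
  define K where "K = {t0 - pi..t0 + pi} - ball t0 \<eta>"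
  have K: "compact K" unfolding K_def by (intro compact_diff) auto
  have Kne: "W t \<noteq> W t0" if "t \<in> K" for t
  proof
    assume "W t = W t0"
    then have "cis (t - t0) = 1" using W_eq_iff cis_divide[of t t0] by simp
    moreover have "\<bar>t - t0\<bar> \<le> pi" using that by (auto simp: K_def abs_le_iff)
    ultimately have "t - t0 = 0" using small_cis_eq_1 by blast
    then show False using that \<open>\<eta> > 0\<close> by (simp add: K_def)
  qed
  have "closed (W ` K)" using K by (intro compact_imp_closed compact_continuous_image W_continuous)
  then have "open (- (W ` K))" "W t0 \<in> - (W ` K)" using Kne by force+
  then have "eventually (\<lambda>n. W (s n) \<in> - (W ` K)) sequentially"
    using lim topological_tendstoD by blast
  then show "eventually (\<lambda>n. dist (s n) t0 < \<eta>) sequentially"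
  proof eventually_elim
    case (elim n)
    then have "s n \<notin> K" by blast
    then show ?case using near[of n] by (auto simp: K_def dist_commute abs_le_iff)
  qed
qed

text \<open>
  Under the powers of \<open>A\<close> every point \<open>q\<close> of the knot other than the repelling one comes back to \<open>a\<close> along
  the knot. So the behaviour of a projectively well-defined quantity \<open>R\<close> on the orbit of \<open>q\<close> can be read off from
  the curve near the parameter of \<open>a\<close>.
\<close>

lemma orbit_ratio_limit:
  assumes A: "A \<in> H" and fr: "loxodromic_frame A l u a b c" and a: "a = k *s W t0"
    and q: "q \<in> limit_cone" "herm q b \<noteq> 0" "herm q a \<noteq> 0"
    and R: "\<And>m z. m \<noteq> 0 \<Longrightarrow> R (m *s z) = R z" and lim: "((\<lambda>t. R (W t)) \<longlongrightarrow> L) (at t0)"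
  shows "(\<lambda>n. R (((*v) A ^^ n) q)) \<longlonglongrightarrow> L"
proof -
  note d = loxodromic_frameD[OF fr]
  let ?q = "\<lambda>n. ((*v) A ^^ n) q"
  have "\<exists>m t. m \<noteq> 0 \<and> ?q n = m *s W t \<and> \<bar>t - t0\<bar> \<le> pi" for n
  proof -
    obtain m s where ms: "m \<noteq> 0" "?q n = m *s W s"
      using limit_cone_funpow[OF q(1) A, of n] limit_cone_iff by blast
    \<comment> \<open>the parameter of the same point that is closest to \<open>t0\<close>\<close>
    define t where "t = t0 + Arg (cis (s - t0))"
    have "cis (Arg (cis (s - t0))) = cis (s - t0)" by (simp add: cis_Arg)
    then have "cis t = cis t0 * cis (s - t0)" by (simp add: t_def flip: cis_mult)
    also have "\<dots> = cis s" by (simp add: cis_mult)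
    finally have "cis t = cis s" .
    then have "W t = W s" using W_eq_iff by blast
    moreover have "\<bar>t - t0\<bar> \<le> pi"
      using Arg_bounded[of "cis (s - t0)"] by (simp add: t_def abs_le_iff)
    ultimately show ?thesis using ms by metis
  qed
  then obtain m t where mt: "\<And>n. m n \<noteq> 0" "\<And>n. ?q n = m n *s W (t n)" "\<And>n. \<bar>t n - t0\<bar> \<le> pi"
    by metis
  let ?h = "herm q b"
  have conv: "(\<lambda>n. (1 / l) ^ n *s ?q n) \<longlonglongrightarrow> ?h *s a" by (rule loxodromic_power_converges[OF fr])
  have W: "W (t n) = (1 / (((1 / l) ^ n *s ?q n)$3)) *s ((1 / l) ^ n *s ?q n)" for n
    using mt(1)[of n] d(7) by (simp add: mt(2) W_third)
  have k: "k \<noteq> 0" using a null_frameD[OF d(1)] by auto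
  have "(\<lambda>n. W (t n)) \<longlonglongrightarrow> (1 / ((?h *s a)$3)) *s (?h *s a)"
    unfolding W by (intro tendsto_scale tendsto_divide tendsto_const tendsto_vec_nth conv)
      (simp add: a k q W_third)
  also have "(1 / ((?h *s a)$3)) *s (?h *s a) = W t0"
    using k q by (simp add: a W_third)
  finally have "t \<longlonglongrightarrow> t0" using parameters_converge mt(3) by blast
  moreover have "t n \<noteq> t0" for n
  proof
    assume "t n = t0"
    then have "herm (?q n) a = 0" by (simp add: mt(2) a herm_linear W_null)
    then show False using loxodromic_frame_power_coordinates(2)[OF fr, of n q] q(3) d(7) by simp
  qed
  ultimately have "filterlim t (at t0) sequentially"
    by (simp add: filterlim_at)
  from filterlim_compose[OF lim this]
  show ?thesis by (simp add: mt(1,2) R)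
qed

end

section \<open>Knots transverse to the contact plane\<close>

context invariant_knot
begin

lemma W_proportional: "W s = k *s W t \<Longrightarrow> W s = W t"
  by (metis W_third mult_1_right vec.scale_one vector_smult_component)

text \<open>
  If a curve \<open>P\<close> is conjugated by \<open>A\<close> to multiplication with \<open>\<rho>\<close>, then it suffices to know its points with small
  parameter, since every parameter becomes small after some steps. Applied to chains and parabolas.
\<close>

lemma contraction_covers:
  fixes P :: "real \<Rightarrow> complex^3"
  assumes A: "A \<in> H" and "l \<noteq> 0" and P: "\<And>x. A *v P x = l *s P (\<rho> * x)" and \<rho>: "\<bar>\<rho>\<bar> < 1"
    and "\<epsilon> > 0" and small: "\<And>x. \<bar>x\<bar> < \<epsilon> \<Longrightarrow> P x \<in> limit_cone"
  shows "P x \<in> limit_cone"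
proof -
  have pull: "P y \<in> limit_cone" if "P (\<rho> * y) \<in> limit_cone" for y
  proof -
    have "matrix_inv A *v (l *s P (\<rho> * y)) \<in> limit_cone"
      using that by (intro limit_cone_invariant limit_cone_scale H_inv A \<open>l \<noteq> 0\<close>)
    then show ?thesis
      by (simp add: P[symmetric] matrix_inv_vec[OF U21_invertible[OF H_U21[OF A]]])
  qed
  have pull_n: "P (\<rho> ^ n * y) \<in> limit_cone \<Longrightarrow> P y \<in> limit_cone" for n y
  proof (induction n)
    case (Suc n)
    then show ?case using pull[of "\<rho> ^ n * y"] by (simp add: mult.assoc)
  qed simp
  have "(\<lambda>n. \<rho> ^ n * x) \<longlonglongrightarrow> 0"
    using \<rho> by (intro tendsto_mult_left_zero LIMSEQ_power_zero) simp
  then have "eventually (\<lambda>n. \<bar>\<rho> ^ n * x\<bar> < \<epsilon>) sequentially"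
    using \<open>\<epsilon> > 0\<close> by (auto dest: tendstoD simp: dist_real_def)
  then obtain n where "\<bar>\<rho> ^ n * x\<bar> < \<epsilon>"
    using eventually_happens' trivial_limit_sequentially by blast
  then show ?thesis using pull_n small by blast
qed

text \<open>
  The function \<open>f\<close> extracts a real coordinate on the model curve. Since the knot runs through \<open>a\<close> with nonzero
  speed in this coordinate, it covers a neighbourhood of \<open>a\<close> in the model curve.
\<close>

lemma coordinate_covers:
  assumes Z: "herm (W t0) b \<noteq> 0" and v: "herm (W t0) v = 0"
    and f: "bounded_linear f" and d: "f (herm (W1 t0) v / herm (W t0) b) \<noteq> (0::real)"
  obtains \<epsilon> where "\<epsilon> > 0"
    "\<And>y. \<bar>y\<bar> < \<epsilon> \<Longrightarrow> \<exists>t. herm (W t) b \<noteq> 0 \<and> f (herm (W t) v / herm (W t) b) = y"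
proof -
  interpret f: bounded_linear f by (rule f)
  let ?g = "\<lambda>t. f (herm (W t) v / herm (W t) b)"
  have contZ: "continuous_on S (\<lambda>t. herm (W t) w)" for S w
    using has_vector_derivative_continuous[OF W_coordinate_deriv(1)] continuous_at_imp_continuous_on
    by blast
  have limZ: "((\<lambda>t. herm (W t) b) \<longlongrightarrow> herm (W t0) b) (at t0)"
    using contZ[of UNIV b] by (simp add: continuous_on_def)
  then have "eventually (\<lambda>t. herm (W t) b \<noteq> 0) (at t0)"
    using Z tendsto_imp_eventually_ne by blast
  then obtain \<delta> where \<delta>: "\<delta> > 0" "\<And>t. t \<noteq> t0 \<Longrightarrow> dist t t0 < \<delta> \<Longrightarrow> herm (W t) b \<noteq> 0"
    unfolding eventually_at by blast
  have near: "herm (W t) b \<noteq> 0" if "t \<in> {t0 - \<delta>/2..t0 + \<delta>/2}" for t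
    using \<delta> that Z by (cases "t = t0") (auto simp: dist_real_def abs_le_iff intro!: \<delta>(2))
  have cont: "continuous_on {t0 - \<delta>/2..t0 + \<delta>/2} ?g"
    by (intro f.continuous_on continuous_on_divide contZ) (use near in blast)
  have "((\<lambda>t. f ((herm (W t) v / of_real (t - t0)) / herm (W t) b)) \<longlongrightarrow>
      f (herm (W1 t0) v / herm (W t0) b)) (at t0)"
    by (intro f.tendsto tendsto_divide has_vector_derivative_complex_quotient
        W_coordinate_deriv v limZ Z)
  moreover have "f ((herm (W t) v / of_real (t - t0)) / herm (W t) b) = (?g t - ?g t0) / (t - t0)" for t
  proof -
    have "(herm (W t) v / of_real (t - t0)) / herm (W t) b
        = (1 / (t - t0)) *\<^sub>R (herm (W t) v / herm (W t) b)"
      by (simp add: scaleR_conv_of_real)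
    then show ?thesis by (simp only: f.scaleR) (simp add: v f.zero)
  qed
  ultimately have "(?g has_real_derivative f (herm (W1 t0) v / herm (W t0) b)) (at t0)"
    by (simp add: has_field_derivative_iff)
  from covers_neighbourhood[OF _ cont _ this d] \<delta>(1) v f.zero
  obtain \<epsilon> where "\<epsilon> > 0" "\<And>y. \<bar>y\<bar> < \<epsilon> \<Longrightarrow> \<exists>t\<in>{t0 - \<delta>/2..t0 + \<delta>/2}. ?g t = y"
    by auto
  then show ?thesis using that near by metis
qed

lemma attracting_param:
  assumes "A \<in> H" "loxodromic_frame A l u a b c"
  obtains k t where "k \<noteq> 0" "a = k *s W t"
  using attracting_in_limit_cone[OF assms] limit_cone_iff by blast

lemma repelling_in_limit_cone:
  assumes "A \<in> H" "loxodromic_frame A l u a b c"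
  shows "b \<in> limit_cone"
  using attracting_in_limit_cone[OF H_inv[OF assms(1)] loxodromic_frame_inverse[OF H_U21[OF assms(1)] assms(2)]] .

text \<open>
  In the transverse case the denominator of \<open>herm z c / herm z a\<close> vanishes to first order at \<open>t0\<close>, so the quotient
  has a finite limit. Its value at \<open>(*v) A ^^ n\<close> of \<open>q\<close> grows like \<open>\<bar>l\<bar> ^ n\<close> unless it is zero.
\<close>

lemma transverse_in_complex_line:
  assumes A: "A \<in> H" and fr: "loxodromic_frame A l u a b c" and a: "a = k *s W t0"
    and transverse: "herm (W1 t0) (W t0) \<noteq> 0" and q: "q \<in> limit_cone"
  shows "herm q c = 0"
proof (cases "herm q a = 0 \<or> herm q b = 0")
  case True
  note d = loxodromic_frameD[OF fr]
  note f = null_frameD[OF d(1)]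
  from True show ?thesis
    using null_frame_null_cases(3)[OF d(1) limit_cone_null[OF q]] by auto
next
  case False
  note d = loxodromic_frameD[OF fr]
  note f = null_frameD[OF d(1)]
  have k: "k \<noteq> 0" using a f by auto
  let ?R = "\<lambda>z. herm z c / herm z a"
  have a0: "herm (W t0) a = 0" "herm (W t0) c = 0"
    using a f k by (simp_all add: herm_linear W_null)
  have "((\<lambda>t. (herm (W t) c / of_real (t - t0)) / (herm (W t) a / of_real (t - t0)))
      \<longlongrightarrow> herm (W1 t0) c / herm (W1 t0) a) (at t0)"
    using transverse k
    by (intro tendsto_divide has_vector_derivative_complex_quotient W_coordinate_deriv a0)
      (simp add: a herm_linear)
  then have lim: "((\<lambda>t. ?R (W t)) \<longlongrightarrow> herm (W1 t0) c / herm (W1 t0) a) (at t0)"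
    by (rule Lim_transform_eventually) (auto simp: eventually_at_filter)
  have "(\<lambda>n. ?R (((*v) A ^^ n) q)) \<longlonglongrightarrow> herm (W1 t0) c / herm (W1 t0) a"
    by (rule orbit_ratio_limit[OF A fr a q _ _ _ lim]) (use False in \<open>auto simp: herm_linear\<close>)
  moreover have "?R (((*v) A ^^ n) q) = (u * cnj l) ^ n * ?R q" for n
    by (simp add: loxodromic_frame_power_coordinates[OF fr] power_mult_distrib power_divide)
  ultimately have "?R q = 0"
    using d by (intro power_mult_convergent_imp_zero[of "u * cnj l"]) (simp_all add: norm_mult)
  then show ?thesis using False by simp
qed

text \<open>
  On the chain \<open>herm z a / herm z b\<close> is imaginary, and its imaginary part is a coordinate with nonzero speed at
  \<open>t0\<close>. So the limit set contains a neighbourhood of \<open>a\<close> in the chain, and by the action of \<open>A\<close> all of it.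
\<close>

lemma transverse_limit_cone:
  assumes A: "A \<in> H" and fr: "loxodromic_frame A l u a b c" and a: "a = k *s W t0"
    and transverse: "herm (W1 t0) (W t0) \<noteq> 0"
  shows "limit_cone = {z. z \<noteq> 0 \<and> herm z z = 0 \<and> herm z c = 0}"
proof
  note d = loxodromic_frameD[OF fr]
  note f = null_frameD[OF d(1)]
  have k: "k \<noteq> 0" using a f by auto
  have c0: "herm q c = 0" if "q \<in> limit_cone" for q
    by (rule transverse_in_complex_line[OF A fr a transverse that])
  show "limit_cone \<subseteq> {z. z \<noteq> 0 \<and> herm z z = 0 \<and> herm z c = 0}"
    using limit_cone_nonzero limit_cone_null c0 by blast
  have a0: "herm (W t0) a = 0" using a f k by (simp add: herm_linear W_null)
  have b0: "herm (W t0) b \<noteq> 0" using a f k by (auto simp: herm_linear)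
  have imag: "Re (herm z a / herm z b) = 0" if "herm z z = 0" "herm z c = 0" for z
    using null_frame_null_cases(3)[OF d(1) that(1)] that(2)
    by (simp add: Re_divide mult.commute)
  let ?D = "herm (W1 t0) a / herm (W t0) b"
  have limb: "((\<lambda>t. herm (W t) b) \<longlongrightarrow> herm (W t0) b) (at t0)"
    using has_vector_derivative_continuous[OF W_coordinate_deriv(1)] by (simp add: continuous_at)
  have "((\<lambda>t. Re ((herm (W t) a / of_real (t - t0)) / herm (W t) b)) \<longlongrightarrow> Re ?D) (at t0)"
    by (intro tendsto_Re tendsto_divide has_vector_derivative_complex_quotient
        W_coordinate_deriv a0 limb b0)
  moreover have "Re ((herm (W t) a / of_real (t - t0)) / herm (W t) b) = 0" for t
  proof -
    have "(herm (W t) a / of_real (t - t0)) / herm (W t) b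
        = of_real (1 / (t - t0)) * (herm (W t) a / herm (W t) b)" by simp
    then show ?thesis
      using imag[OF W_null c0[OF W_in_limit_cone], of t] by (simp only: Re_complex_of_real Im_complex_of_real times_complex.sel)
  qed
  ultimately have "Re ?D = 0" by (simp add: tendsto_const_iff)
  moreover have "?D \<noteq> 0" using transverse b0 k by (simp add: a herm_linear)
  ultimately have "Im ?D \<noteq> 0" by (simp add: complex_eq_iff)
  then obtain \<epsilon> where \<epsilon>: "\<epsilon> > 0"
      "\<And>y. \<bar>y\<bar> < \<epsilon> \<Longrightarrow> \<exists>t. herm (W t) b \<noteq> 0 \<and> Im (herm (W t) a / herm (W t) b) = y"
    using coordinate_covers[OF b0 a0 bounded_linear_Im] by blast
  define P where "P y = a + (\<i> * of_real y) *s b" for y :: real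
  have P_param: "z = herm z b *s P (Im (herm z a / herm z b))"
    if "herm z z = 0" "herm z c = 0" "herm z b \<noteq> 0" for z
  proof -
    have "herm z a / herm z b = \<i> * of_real (Im (herm z a / herm z b))"
      using imag[OF that(1,2)] by (simp add: complex_eq_iff)
    then have "herm z a = herm z b * (\<i> * of_real (Im (herm z a / herm z b)))"
      using that(3) by (simp add: field_simps)
    then have "herm z b *s P (Im (herm z a / herm z b)) = herm z b *s a + herm z a *s b"
      unfolding P_def vec.scale_right_distrib vec.scale_scale by simp
    then show ?thesis using null_frame_expand[OF d(1), of z] that(2) by simp
  qed
  have "P y \<in> limit_cone" for y
  proof (rule contraction_covers[OF A d(7) _ _ \<epsilon>(1)])
    show "\<bar>1 / (cmod l)\<^sup>2\<bar> < 1" using d(5) by (simp add: divide_less_eq one_less_power)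
    fix x
    have "l * (\<i> * complex_of_real (1 / (cmod l)\<^sup>2 * x)) = \<i> * of_real x * (1 / cnj l)"
    proof -
      have norm: "complex_of_real (1 / (cmod l)\<^sup>2) = 1 / (l * cnj l)"
        using complex_norm_square[of l] by simp
      show ?thesis unfolding of_real_mult norm using d(7) by simp
    qed
    then show "A *v P x = l *s P (1 / (cmod l)\<^sup>2 * x)"
      unfolding P_def matrix_vector_right_distrib mult_vec_scale d(2,3) vec.scale_right_distrib vec.scale_scale
      by simp
  next
    fix y :: real assume "\<bar>y\<bar> < \<epsilon>"
    then obtain t where t: "herm (W t) b \<noteq> 0" "Im (herm (W t) a / herm (W t) b) = y"
      using \<epsilon>(2) by blast
    then have "W t = herm (W t) b *s P y"
      using P_param[OF W_null c0[OF W_in_limit_cone] t(1)] by simp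
    then have "P y = (1 / herm (W t) b) *s W t" using t(1)
      by (metis nonzero_eq_divide_eq vec.scale_one vec.scale_scale)
    then show "P y \<in> limit_cone" using t(1) limit_cone_scale[OF W_in_limit_cone] by simp
  qed
  then have P: "m *s P y \<in> limit_cone" if "m \<noteq> 0" for m y using limit_cone_scale that by blast
  show "{z. z \<noteq> 0 \<and> herm z z = 0 \<and> herm z c = 0} \<subseteq> limit_cone"
  proof
    fix z assume z: "z \<in> {z. z \<noteq> 0 \<and> herm z z = 0 \<and> herm z c = 0}"
    show "z \<in> limit_cone"
    proof (cases "herm z b = 0")
      case True
      then have "z = herm z a *s b" using null_frame_null_cases(2)[OF d(1)] z by blast
      moreover then have "herm z a \<noteq> 0" using z by auto
      ultimately show ?thesis
        using limit_cone_scale[OF repelling_in_limit_cone[OF A fr]] by metis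
    next
      case False
      then have "z = herm z b *s P (Im (herm z a / herm z b))" using P_param z by blast
      then show ?thesis using P[OF False] by metis
    qed
  qed
qed

end

section \<open>Knots tangent to the contact plane\<close>

lemma real_multiple_of_unit:
  fixes y w :: complex
  assumes "cmod w = 1" "y\<^sup>2 / of_real ((cmod y)\<^sup>2) = w\<^sup>2"
  obtains x :: real where "y = of_real x * w"
proof -
  have "y \<noteq> 0" using assms by auto
  then have "y\<^sup>2 = (of_real (cmod y) * w)\<^sup>2"
    using assms(2) by (simp add: field_simps power_mult_distrib)
  then have "y = of_real (cmod y) * w \<or> y = of_real (- cmod y) * w"
    by (simp add: power2_eq_iff)
  then show ?thesis using that by blast
qed

context invariant_knot
begin

text \<open>
  The two fixed points correspond to two parameters on the circle, and the circle has more than two points.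
\<close>

lemma exists_generic_point:
  assumes A: "A \<in> H" and fr: "loxodromic_frame A l u a b c"
  obtains q where "q \<in> limit_cone" "herm q a \<noteq> 0" "herm q b \<noteq> 0"
proof -
  note d = loxodromic_frameD[OF fr]
  note f = null_frameD[OF d(1)]
  obtain k t0 where a: "k \<noteq> 0" "a = k *s W t0" using attracting_param[OF A fr] .
  obtain m t1 where b: "m \<noteq> 0" "b = m *s W t1"
    using repelling_in_limit_cone[OF A fr] limit_cone_iff by blast
  have "\<exists>z. cmod z = 1 \<and> z \<noteq> cis t0 \<and> z \<noteq> cis t1"
  proof -
    have "(1::complex) \<noteq> -1" "\<i> \<noteq> 1" "\<i> \<noteq> -1" by (simp_all add: complex_eq_iff)
    moreover have "cmod 1 = 1" "cmod (-1) = 1" "cmod \<i> = 1" by simp_all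
    ultimately show ?thesis by metis
  qed
  then obtain z where z: "cmod z = 1" "z \<noteq> cis t0" "z \<noteq> cis t1" by blast
  define t where "t = Arg z"
  have "z \<noteq> 0" using z(1) by auto
  then have t: "cis t = z" using z(1) by (simp add: t_def cis_Arg sgn_eq)
  have "W t \<noteq> W t0" "W t \<noteq> W t1" using z t W_eq_iff by metis+
  moreover have "W t = W t0" if "herm (W t) a = 0"
  proof -
    have "herm (W t0) (W t) = 0" using that a by (simp add: herm_linear herm_eq_0_swap)
    then show ?thesis
      using null_orthogonal_proportional[OF W_null W_null _ W_nonzero] W_proportional by metis
  qed
  moreover have "W t = W t1" if "herm (W t) b = 0"
  proof -
    have "herm (W t1) (W t) = 0" using that b by (simp add: herm_linear herm_eq_0_swap)
    then show ?thesis
      using null_orthogonal_proportional[OF W_null W_null _ W_nonzero] W_proportional by metis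
  qed
  ultimately show ?thesis using that W_in_limit_cone by blast
qed

text \<open>
  In the tangent case \<open>herm (W t) a\<close> vanishes to second order at \<open>t0\<close>, and \<open>herm (W t) c\<close> to first order exactly.
  Both \<open>herm z b * herm z a / (herm z c)^2\<close> and the square of the unit complex number in the direction of
  \<open>herm z c * cnj (herm z b)\<close> have limits at \<open>t0\<close>, and \<open>A\<close> multiplies them by unit complex numbers. The first
  limit is not zero, so the unit factor must be \<open>1\<close>, which is the relation between \<open>l\<close> and \<open>u\<close>; the
  second factor is its inverse. Thus both quantities are constant on the limit set away from the
  fixed points. The real part of \<open>M\<close> comes from the vanishing of the form.
\<close>

lemma tangent_parabola:
  assumes A: "A \<in> H" and fr: "loxodromic_frame A l u a b c" and a: "a = k *s W t0"
    and tangent: "herm (W1 t0) (W t0) = 0"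
  obtains w M r where "cmod w = 1" "Re M = - 1 / 2" "l = u\<^sup>2 * cnj l"
    "herm (W1 t0) c = of_real r * w * herm (W t0) b" "r \<noteq> 0"
    "\<And>q. q \<in> limit_cone \<Longrightarrow> herm q b \<noteq> 0 \<Longrightarrow>
      \<exists>x::real. herm q c = of_real x * w * herm q b \<and> herm q a = M * (of_real x)\<^sup>2 * herm q b"
proof -
  note d = loxodromic_frameD[OF fr]
  note f = null_frameD[OF d(1)]
  note power_coords = loxodromic_frame_power_coordinates[OF fr]
  have k: "k \<noteq> 0" using a f by auto
  have t0: "herm (W t0) a = 0" "herm (W t0) c = 0" "herm (W t0) b \<noteq> 0"
    using a f k by (auto simp: herm_linear W_null)
  have W1a: "herm (W1 t0) a = 0" using tangent by (simp add: a herm_linear)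
  define dc where "dc = herm (W1 t0) c"
  define B where "B = herm (W t0) b"
  have "dc \<noteq> 0"
  proof
    assume "dc = 0"
    then have "W1 t0 = herm (W1 t0) b *s a"
      using null_frame_expand[OF d(1), of "W1 t0"] W1a by (simp add: dc_def)
    then show False using W1_not_parallel by (simp add: a)
  qed
  have "B \<noteq> 0" using t0 by (simp add: B_def)
  have limb: "((\<lambda>t. herm (W t) b) \<longlongrightarrow> B) (at t0)"
    using has_vector_derivative_continuous[OF W_coordinate_deriv(1)] by (simp add: continuous_at B_def)
  have limc: "((\<lambda>t. herm (W t) c / of_real (t - t0)) \<longlongrightarrow> dc) (at t0)"
    unfolding dc_def by (intro has_vector_derivative_complex_quotient W_coordinate_deriv t0)
  have lima: "((\<lambda>t. herm (W t) a / (of_real (t - t0))\<^sup>2) \<longlongrightarrow> herm (W2 t0) a / 2) (at t0)"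
    by (rule second_order_quotient[OF W_coordinate_deriv t0(1) W1a])
  \<comment> \<open>the vanishing of \<open>herm z c\<close> is preserved by \<open>A\<close>, but does not occur on the knot close to \<open>t0\<close>\<close>
  have c_nonzero: "herm q c \<noteq> 0" if q: "q \<in> limit_cone" "herm q a \<noteq> 0" "herm q b \<noteq> 0" for q
  proof
    assume qc: "herm q c = 0"
    let ?R = "\<lambda>z. if herm z c = 0 then 1 else 0 :: complex"
    have "eventually (\<lambda>t. herm (W t) c / of_real (t - t0) \<noteq> 0) (at t0)"
      using limc \<open>dc \<noteq> 0\<close> tendsto_imp_eventually_ne by blast
    then have lim: "((\<lambda>t. ?R (W t)) \<longlongrightarrow> 0) (at t0)"
      by (intro tendsto_eventually) (auto elim: eventually_mono)
    have "(\<lambda>n. ?R (((*v) A ^^ n) q)) \<longlonglongrightarrow> 0"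
      by (rule orbit_ratio_limit[OF A fr a q(1,3,2) _ lim]) (simp add: herm_linear)
    then show False using qc by (simp add: power_coords LIMSEQ_const_iff)
  qed
  define m where "m = B * (herm (W2 t0) a / 2) / dc\<^sup>2"
  let ?R = "\<lambda>z. herm z b * herm z a / (herm z c)\<^sup>2"
  have "((\<lambda>t. herm (W t) b * (herm (W t) a / (of_real (t - t0))\<^sup>2) /
      (herm (W t) c / of_real (t - t0))\<^sup>2) \<longlongrightarrow> m) (at t0)"
    unfolding m_def using \<open>dc \<noteq> 0\<close> by (intro tendsto_intros limb lima limc) simp
  then have limR: "((\<lambda>t. ?R (W t)) \<longlongrightarrow> m) (at t0)"
    by (rule Lim_transform_eventually) (auto simp: eventually_at_filter power_divide)
  define v where "v = l / (cnj l * u\<^sup>2)"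
  have v: "cmod v = 1" using d by (simp add: v_def norm_divide norm_mult norm_power)
  have R_power: "(\<lambda>n. v ^ n * ?R q) \<longlonglongrightarrow> m"
    if q: "q \<in> limit_cone" "herm q a \<noteq> 0" "herm q b \<noteq> 0" for q
  proof -
    have "(\<lambda>n. ?R (((*v) A ^^ n) q)) \<longlonglongrightarrow> m"
      by (rule orbit_ratio_limit[OF A fr a q(1,3,2) _ limR]) (simp add: herm_linear power2_eq_square)
    moreover have "?R (((*v) A ^^ n) q) = v ^ n * ?R q" for n
      by (simp add: power_coords v_def power_mult_distrib power_divide flip: power_mult)
        (simp add: mult.commute mult.left_commute)
    ultimately show ?thesis by simp
  qed
  have R_m: "v = 1 \<and> ?R q = m" if q: "q \<in> limit_cone" "herm q a \<noteq> 0" "herm q b \<noteq> 0" for q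
    using unit_power_mult_limit[OF v _ R_power[OF q]] q c_nonzero[OF q] by simp
  obtain q0 where q0: "q0 \<in> limit_cone" "herm q0 a \<noteq> 0" "herm q0 b \<noteq> 0"
    using exists_generic_point[OF A fr] by blast
  have v1: "v = 1" using R_m[OF q0] by blast
  then have lu: "l = u\<^sup>2 * cnj l" using d by (simp add: v_def field_simps)
  \<comment> \<open>the direction of the velocity of \<open>herm (W t) c / herm (W t) b\<close> at \<open>t0\<close>\<close>
  define w where "w = sgn (dc * cnj B)"
  have w: "cmod w = 1" using \<open>dc \<noteq> 0\<close> \<open>B \<noteq> 0\<close> by (simp add: w_def norm_sgn)
  let ?S = "\<lambda>z. (herm z c * cnj (herm z b))\<^sup>2 / of_real ((cmod (herm z c * cnj (herm z b)))\<^sup>2)"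
  have "((\<lambda>t. (herm (W t) c / of_real (t - t0) * cnj (herm (W t) b))\<^sup>2 /
      of_real ((cmod (herm (W t) c / of_real (t - t0) * cnj (herm (W t) b)))\<^sup>2))
      \<longlongrightarrow> (dc * cnj B)\<^sup>2 / of_real ((cmod (dc * cnj B))\<^sup>2)) (at t0)"
    using \<open>dc \<noteq> 0\<close> \<open>B \<noteq> 0\<close> by (intro tendsto_intros limb limc) simp
  also have "(dc * cnj B)\<^sup>2 / of_real ((cmod (dc * cnj B))\<^sup>2) = w\<^sup>2"
    by (simp add: w_def sgn_eq power_divide)
  finally have limS: "((\<lambda>t. ?S (W t)) \<longlongrightarrow> w\<^sup>2) (at t0)"
  proof (rule Lim_transform_eventually)
    have *: "(x / of_real s * y)\<^sup>2 / of_real ((cmod (x / of_real s * y))\<^sup>2)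
        = (x * y)\<^sup>2 / of_real ((cmod (x * y))\<^sup>2)" if "s \<noteq> 0" for x y :: complex and s :: real
      using that by (simp add: norm_mult norm_divide power_mult_distrib power_divide flip: of_real_power)
    then show "\<forall>\<^sub>F t in at t0. (herm (W t) c / of_real (t - t0) * cnj (herm (W t) b))\<^sup>2 /
      of_real ((cmod (herm (W t) c / of_real (t - t0) * cnj (herm (W t) b)))\<^sup>2) = ?S (W t)"
      unfolding eventually_at_filter by (intro always_eventually allI impI *) simp
  qed
  have S_w: "?S q = w\<^sup>2" if q: "q \<in> limit_cone" "herm q a \<noteq> 0" "herm q b \<noteq> 0" for q
  proof -
    have scale: "(e * y)\<^sup>2 / of_real ((cmod (e * y))\<^sup>2) = e\<^sup>2 / of_real ((cmod e)\<^sup>2) * (y\<^sup>2 / of_real ((cmod y)\<^sup>2))" for e y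
      by (simp add: norm_mult power_mult_distrib)
    have S_scale: "?S (m *s z) = ?S z" if "m \<noteq> 0" for m z
    proof -
      have "herm (m *s z) c * cnj (herm (m *s z) b) = of_real ((cmod m)\<^sup>2) * (herm z c * cnj (herm z b))"
        using complex_norm_square[of m] by (simp add: herm_linear)
      then show ?thesis using that by (simp only: scale) (simp flip: of_real_power)
    qed
    have "(\<lambda>n. ?S (((*v) A ^^ n) q)) \<longlonglongrightarrow> w\<^sup>2"
      by (rule orbit_ratio_limit[OF A fr a q(1,3,2) S_scale limS])
    moreover have "?S (((*v) A ^^ n) q) = ?S q" for n
    proof -
      define e where "e = u ^ n * cnj l ^ n"
      have "e\<^sup>2 = (u\<^sup>2 * cnj l) ^ n * cnj l ^ n"
        by (simp add: e_def power2_eq_square power_mult_distrib)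
      also have "\<dots> = of_real ((cmod l)\<^sup>2) ^ n"
        using lu complex_norm_square[of l] by (simp add: power_mult_distrib)
      also have "\<dots> = of_real ((cmod e)\<^sup>2)"
        using d(6) by (simp add: e_def norm_mult norm_power flip: power_mult) (simp add: mult.commute)
      finally have "e\<^sup>2 / of_real ((cmod e)\<^sup>2) = 1"
        using d by (simp add: e_def)
      moreover have "herm (((*v) A ^^ n) q) c * cnj (herm (((*v) A ^^ n) q) b)
          = e * (herm q c * cnj (herm q b))"
        by (simp add: power_coords e_def)
      ultimately show ?thesis by (simp only: scale mult_1_left)
    qed
    ultimately show ?thesis by (simp add: LIMSEQ_const_iff)
  qed
  define M where "M = m * w\<^sup>2"
  have param: "\<exists>x::real. herm q c = of_real x * w * herm q b \<and> herm q a = M * (of_real x)\<^sup>2 * herm q b"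
    if q: "q \<in> limit_cone" "herm q b \<noteq> 0" for q
  proof (cases "herm q a = 0")
    case True
    then have "herm q c = 0"
      using null_frame_null_cases(3)[OF d(1) limit_cone_null[OF q(1)]] by simp
    then show ?thesis using True by (intro exI[of _ 0]) simp
  next
    case False
    obtain y :: real where y: "herm q c * cnj (herm q b) = of_real y * w"
      using real_multiple_of_unit[OF w S_w[OF q(1) False q(2)]] by blast
    define x where "x = y / (cmod (herm q b))\<^sup>2"
    have nb: "complex_of_real ((cmod (herm q b))\<^sup>2) = herm q b * cnj (herm q b)"
      by (rule complex_norm_square)
    have "(of_real x * w * herm q b) * cnj (herm q b) = of_real x * of_real ((cmod (herm q b))\<^sup>2) * w"
      unfolding nb by simp
    also have "\<dots> = herm q c * cnj (herm q b)" using q by (simp add: x_def y)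
    finally have c: "herm q c = of_real x * w * herm q b" using q(2) by simp
    have "herm q b * herm q a = m * (herm q c)\<^sup>2"
      using R_m[OF q(1) False q(2)] c_nonzero[OF q(1) False q(2)] by (auto simp: field_simps)
    also have "\<dots> = herm q b * (M * (of_real x)\<^sup>2 * herm q b)"
      by (simp add: c M_def power2_eq_square)
    finally show ?thesis using c q(2) by auto
  qed
  have "Re M = - 1 / 2"
  proof -
    obtain x :: real where x: "herm q0 c = of_real x * w * herm q0 b"
        "herm q0 a = M * (of_real x)\<^sup>2 * herm q0 b"
      using param[OF q0(1,3)] by blast
    have "x \<noteq> 0" using x(2) q0 by auto
    have "herm q0 b * cnj (herm q0 a) = of_real (x\<^sup>2 * (cmod (herm q0 b))\<^sup>2) * cnj M"
      unfolding x(2) using complex_norm_square[of "herm q0 b"] by simp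
    then have "Re (herm q0 b * cnj (herm q0 a)) = x\<^sup>2 * (cmod (herm q0 b))\<^sup>2 * Re M"
      by (simp only: Re_complex_of_real Im_complex_of_real times_complex.sel) simp
    moreover have "(cmod (herm q0 c))\<^sup>2 = x\<^sup>2 * (cmod (herm q0 b))\<^sup>2"
      by (simp add: x(1) norm_mult w power_mult_distrib)
    ultimately have "x\<^sup>2 * (cmod (herm q0 b))\<^sup>2 * (2 * Re M + 1) = 0"
      using null_frame_null_cases(3)[OF d(1) limit_cone_null[OF q0(1)]] by (simp add: algebra_simps)
    then show ?thesis using \<open>x \<noteq> 0\<close> q0(3) by simp
  qed
  moreover have "herm (W1 t0) c = of_real (cmod (dc * cnj B) / (cmod B)\<^sup>2) * w * herm (W t0) b"
  proof -
    have "w * of_real (cmod (dc * cnj B)) = dc * cnj B"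
      using \<open>dc \<noteq> 0\<close> \<open>B \<noteq> 0\<close> by (simp add: w_def sgn_eq)
    then have "of_real (cmod (dc * cnj B) / (cmod B)\<^sup>2) * w * B = dc * (cnj B * B) / of_real ((cmod B)\<^sup>2)"
      by (simp add: ac_simps)
    also have "\<dots> = dc" using \<open>B \<noteq> 0\<close> complex_norm_square[of B] by (simp add: mult.commute)
    finally show ?thesis by (simp add: dc_def B_def)
  qed
  moreover have "cmod (dc * cnj B) / (cmod B)\<^sup>2 \<noteq> 0"
    using \<open>dc \<noteq> 0\<close> \<open>B \<noteq> 0\<close> by simp
  ultimately show ?thesis using that w lu param by blast
qed

end

lemma null_frame_rotate:
  assumes "null_frame a b c" "cmod w = 1"
  shows "null_frame a b (w *s c)"
  using assms complex_norm_square[of w]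
  unfolding null_frame_def by (auto simp: herm_linear mult.commute)

context invariant_knot
begin

text \<open>
  The relation between \<open>l\<close> and \<open>u\<close> makes \<open>u / l\<close> real, with square \<open>1 / \<bar>l\<bar>\<^sup>2\<close>. So \<open>A\<close> acts on the parabola by
  multiplication of the real parameter, and the points near \<open>a\<close> suffice.
\<close>

lemma parabola_points_in_limit_cone:
  assumes A: "A \<in> H" and fr: "loxodromic_frame A l u a b c" and a: "a = k *s W t0"
    and w: "cmod w = 1" and lu: "l = u\<^sup>2 * cnj l"
    and r: "herm (W1 t0) c = of_real r * w * herm (W t0) b" "r \<noteq> 0"
    and param: "\<And>q. q \<in> limit_cone \<Longrightarrow> herm q b \<noteq> 0 \<Longrightarrow>
      \<exists>x::real. herm q c = of_real x * w * herm q b \<and> herm q a = M * (of_real x)\<^sup>2 * herm q b"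
  shows "a + (M * (of_real x)\<^sup>2) *s b + (of_real x * w) *s c \<in> limit_cone"
proof -
  note d = loxodromic_frameD[OF fr]
  note f = null_frameD[OF d(1)]
  have k: "k \<noteq> 0" using a f by auto
  have t0: "herm (W t0) c = 0" "herm (W t0) b \<noteq> 0"
    using a f k by (auto simp: herm_linear)
  have wc: "w * cnj w = 1" using w complex_norm_square[of w] by simp
  have "w \<noteq> 0" using w by auto
  define P where "P x = a + (M * (of_real x)\<^sup>2) *s b + (of_real x * w) *s c" for x :: real
  have bl: "bounded_linear (\<lambda>z. Re (z * cnj w))"
    by (intro bounded_linear_compose[OF bounded_linear_Re] bounded_linear_mult_left)
  have Re_w: "Re (of_real x * w * cnj w) = x" for x
    using wc by (simp add: mult.assoc)
  have "Re (herm (W1 t0) c / herm (W t0) b * cnj w) \<noteq> 0"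
    using r t0 Re_w[of r] by simp
  then obtain \<epsilon> where \<epsilon>: "\<epsilon> > 0" "\<And>y. \<bar>y\<bar> < \<epsilon> \<Longrightarrow>
      \<exists>t. herm (W t) b \<noteq> 0 \<and> Re (herm (W t) c / herm (W t) b * cnj w) = y"
    using coordinate_covers[OF t0(2,1) bl] by blast
  define \<rho> where "\<rho> = Re (u / l)"
  have ul: "(u / l)\<^sup>2 = 1 / of_real ((cmod l)\<^sup>2)"
  proof -
    have "u\<^sup>2 * (l * cnj l) = l\<^sup>2" using lu by (metis mult.assoc mult.commute power2_eq_square)
    then show ?thesis using d(7) complex_norm_square[of l]
      by (simp add: power_divide field_simps)
  qed
  have "u / l = of_real (1 / cmod l) \<or> u / l = of_real (- 1 / cmod l)"
  proof -
    have "(u / l)\<^sup>2 = (of_real (1 / cmod l))\<^sup>2" using ul by (simp add: power_divide)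
    then show ?thesis by (auto simp: power2_eq_iff)
  qed
  then have \<rho>: "u / l = of_real \<rho>" "\<bar>\<rho>\<bar> < 1"
    using d(5) by (auto simp: \<rho>_def divide_less_eq)
  have "P x \<in> limit_cone"
  proof (rule contraction_covers[OF A d(7) _ \<rho>(2) \<epsilon>(1)])
    fix x :: real
    have u: "u = l * of_real \<rho>" using \<rho>(1) d(7) by (simp add: field_simps)
    have norm: "l * (of_real \<rho>)\<^sup>2 = 1 / cnj l"
      using ul d(7) unfolding \<rho>(1) complex_norm_square by (simp add: field_simps)
    have "l * (M * (of_real (\<rho> * x))\<^sup>2) = M * (of_real x)\<^sup>2 * (l * (of_real \<rho>)\<^sup>2)"
      by (simp add: power_mult_distrib)
    then have "l * (M * (of_real (\<rho> * x))\<^sup>2) = M * (of_real x)\<^sup>2 * (1 / cnj l)"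
      unfolding norm .
    moreover have "l * (of_real (\<rho> * x) * w) = of_real x * w * u"
      by (simp add: u)
    ultimately show "A *v P x = l *s P (\<rho> * x)"
      unfolding P_def matrix_vector_right_distrib mult_vec_scale d(2,3,4)
        vec.scale_right_distrib vec.scale_scale by metis
  next
    fix y :: real assume "\<bar>y\<bar> < \<epsilon>"
    then obtain t where t: "herm (W t) b \<noteq> 0" "Re (herm (W t) c / herm (W t) b * cnj w) = y"
      using \<epsilon>(2) by blast
    obtain x :: real where x: "herm (W t) c = of_real x * w * herm (W t) b"
        "herm (W t) a = M * (of_real x)\<^sup>2 * herm (W t) b"
      using param[OF W_in_limit_cone t(1)] by blast
    have "x = y" using t Re_w[of x] by (simp add: x(1))
    have "W t = herm (W t) b *s P y"
      using null_frame_expand[OF d(1), of "W t"] unfolding x P_def \<open>x = y\<close>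
        vec.scale_right_distrib vec.scale_scale by (simp add: mult_ac)
    then have "P y = (1 / herm (W t) b) *s W t" using t(1)
      by (metis nonzero_eq_divide_eq vec.scale_one vec.scale_scale)
    then show "P y \<in> limit_cone" using t(1) limit_cone_scale[OF W_in_limit_cone] by simp
  qed
  then show ?thesis by (simp add: P_def)
qed

text \<open>
  For \<open>M = - 1 / 2\<close> the parabola together with \<open>b\<close> consists, up to complex factors, of the null vectors with real coordinates in the frame
  \<open>a\<close>, \<open>b\<close>, \<open>w *s c\<close>.
\<close>

lemma flat_parabola_limit_cone:
  assumes A: "A \<in> H" and fr: "loxodromic_frame A l u a b c" and w: "cmod w = 1"
    and param: "\<And>q. q \<in> limit_cone \<Longrightarrow> herm q b \<noteq> 0 \<Longrightarrow>
      \<exists>x::real. herm q c = of_real x * w * herm q b \<and> herm q a = (- 1 / 2) * (of_real x)\<^sup>2 * herm q b"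
    and points: "\<And>x::real. a + ((- 1 / 2) * (of_real x)\<^sup>2) *s b + (of_real x * w) *s c \<in> limit_cone"
  shows "limit_cone = {m *s (of_real x *s a + of_real y *s b + of_real v *s (w *s c)) | m x y v.
    m \<noteq> 0 \<and> (x, y, v) \<noteq> (0, 0, 0) \<and> 2 * x * y + v\<^sup>2 = (0::real)}" (is "_ = ?S")
proof (rule subset_antisym; rule subsetI)
  note d = loxodromic_frameD[OF fr]
  note f = null_frameD[OF d(1)]
  fix z assume z: "z \<in> limit_cone"
  show "z \<in> ?S"
  proof (cases "herm z b = 0")
    case True
    then have eq: "z = herm z a *s b"
      using null_frame_null_cases(2)[OF d(1) limit_cone_null[OF z]] by blast
    then have "herm z a \<noteq> 0" using limit_cone_nonzero[OF z] by auto
    then show ?thesis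
      using eq by (intro CollectI exI[of _ "herm z a"] exI[of _ 0] exI[of _ 1] exI[of _ 0]) simp
  next
    case False
    obtain x :: real where x: "herm z c = of_real x * w * herm z b"
        "herm z a = (- 1 / 2) * (of_real x)\<^sup>2 * herm z b"
      using param[OF z False] by blast
    have "z = herm z b *s (of_real 1 *s a + of_real (- (x\<^sup>2) / 2) *s b + of_real x *s (w *s c))"
      using null_frame_expand[OF d(1), of z] unfolding x
        vec.scale_right_distrib vec.scale_scale by (simp add: mult_ac)
    then show ?thesis
      using False by (intro CollectI exI[of _ "herm z b"] exI[of _ 1] exI[of _ "- (x\<^sup>2) / 2"] exI[of _ x]) simp
  qed
next
  note d = loxodromic_frameD[OF fr]
  fix z assume "z \<in> ?S"
  then obtain m x y v where z: "z = m *s (of_real x *s a + of_real y *s b + of_real v *s (w *s c))"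
    "m \<noteq> 0" "(x, y, v) \<noteq> (0, 0, 0)" "2 * x * y + v\<^sup>2 = 0" by blast
  show "z \<in> limit_cone"
  proof (cases "x = 0")
    case True
    then have "v = 0" "y \<noteq> 0" using z by auto
    then have "z = (m * of_real y) *s b" "m * of_real y \<noteq> 0" using True z by simp_all
    then show ?thesis using limit_cone_scale[OF repelling_in_limit_cone[OF A fr]] by metis
  next
    case False
    have y: "y = x * (- 1 / 2 * (v / x)\<^sup>2)"
      using z(4) False by (simp add: power2_eq_square field_simps)
    have "complex_of_real y = of_real x * ((- 1 / 2) * (of_real (v / x))\<^sup>2)"
      by (subst y) simp
    then have "z = (m * of_real x) *s (a + ((- 1 / 2) * (of_real (v / x))\<^sup>2) *s b + (of_real (v / x) * w) *s c)"
      unfolding z(1) vec.scale_right_distrib vec.scale_scale using False by (simp add: mult_ac)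
    moreover have "m * of_real x \<noteq> 0" using False z by simp
    ultimately show ?thesis using limit_cone_scale[OF points] by metis
  qed
qed

text \<open>
  Along the parabola the contact form of the velocity is \<open>(2 * M + 1) * x * x'\<close> up to a positive factor. In
  the proof \<open>s\<close> plays the role of the derivative of \<open>x\<close> and \<open>\<alpha>\<close> that of the logarithmic derivative of
  \<open>herm (W t) b\<close>; differentiating the equation of the parabola expresses the velocity in these terms.
\<close>

lemma bent_parabola_transverse:
  assumes fr: "null_frame a b c" and w: "cmod w = 1" and M: "Re M = - 1 / 2" "Im M \<noteq> 0"
    and param: "\<And>q. q \<in> limit_cone \<Longrightarrow> herm q b \<noteq> 0 \<Longrightarrow>
      \<exists>x::real. herm q c = of_real x * w * herm q b \<and> herm q a = M * (of_real x)\<^sup>2 * herm q b"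
    and t1: "herm (W t1) a \<noteq> 0" "herm (W t1) b \<noteq> 0"
  shows "herm (W1 t1) (W t1) \<noteq> 0"
proof
  assume tangent: "herm (W1 t1) (W t1) = 0"
  have "w \<noteq> 0" using w by auto
  have wc: "w * cnj w = 1" using w complex_norm_square[of w] by simp
  define Z where "Z v = herm (W t1) v" for v
  define Y where "Y v = herm (W1 t1) v" for v
  have identity: "w\<^sup>2 * (herm (W t) b * herm (W t) a) = M * (herm (W t) c * herm (W t) c)" for t
  proof (cases "herm (W t) b = 0")
    case True
    then show ?thesis using null_frame_null_cases(3)[OF fr W_null[of t]] by simp
  next
    case False
    then show ?thesis using param[OF W_in_limit_cone False] by (auto simp: power2_eq_square)
  qed
  have "((\<lambda>t. w\<^sup>2 * (herm (W t) b * herm (W t) a)) has_vector_derivative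
      w\<^sup>2 * (Z b * Y a + Y b * Z a)) (at t1)"
    unfolding Z_def Y_def
    by (intro has_vector_derivative_mult_right has_vector_derivative_mult W_coordinate_deriv)
  moreover have "((\<lambda>t. M * (herm (W t) c * herm (W t) c)) has_vector_derivative
      M * (Z c * Y c + Y c * Z c)) (at t1)"
    unfolding Z_def Y_def
    by (intro has_vector_derivative_mult_right has_vector_derivative_mult W_coordinate_deriv)
  ultimately have der: "w\<^sup>2 * (Z b * Y a + Y b * Z a) = M * (Z c * Y c + Y c * Z c)"
    unfolding identity using vector_derivative_unique_at by blast
  obtain x :: real where x: "Z c = of_real x * w * Z b" "Z a = M * (of_real x)\<^sup>2 * Z b"
    using param[OF W_in_limit_cone t1(2)] unfolding Z_def by blast
  have Zb: "Z b \<noteq> 0" and x0: "x \<noteq> 0" using t1 x by (auto simp: Z_def)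
  define \<alpha> where "\<alpha> = Y b / Z b"
  define s where "s = (Y c - \<alpha> * Z c) / (w * Z b)"
  have Yb: "Y b = \<alpha> * Z b" using Zb by (simp add: \<alpha>_def)
  have Yc: "Y c = s * w * Z b + \<alpha> * Z c" using Zb \<open>w \<noteq> 0\<close> by (simp add: s_def)
  have "w\<^sup>2 * Z b * Y a = w\<^sup>2 * Z b * (2 * M * of_real x * s * Z b + \<alpha> * Z a)"
    using der unfolding Yb Yc x by (simp add: power2_eq_square algebra_simps)
  then have Ya: "Y a = 2 * M * of_real x * s * Z b + \<alpha> * Z a" using Zb \<open>w \<noteq> 0\<close> by simp
  have "M + cnj M + 1 = 0" using M(1) by (simp add: complex_eq_iff)
  then have M': "cnj M = - 1 - M" by (simp add: algebra_simps eq_neg_iff_add_eq_0)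
  have wc': "w * (cnj w * X) = X" for X using wc by (simp flip: mult.assoc)
  have "herm (W1 t1) (W t1) = Y b * cnj (Z a) + Y a * cnj (Z b) + Y c * cnj (Z c)"
    unfolding Y_def Z_def by (rule null_frame_herm[OF fr])
  also have "\<dots> = (2 * M + 1) * of_real x * s * (Z b * cnj (Z b))"
    unfolding Ya Yb Yc x by (simp add: M' wc' power2_eq_square algebra_simps)
  finally have "(2 * M + 1) * of_real x * s * (Z b * cnj (Z b)) = 0" using tangent by simp
  moreover have "2 * M + 1 \<noteq> 0" using M(2) by (simp add: complex_eq_iff)
  ultimately have "s = 0" using Zb x0 by simp
  then have "Y v = \<alpha> * Z v" if "v \<in> {a, b, c}" for v using that Ya Yb Yc by auto
  then have "W1 t1 = \<alpha> *s W t1"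
    using null_frame_expand[OF fr, of "W1 t1"] null_frame_expand[OF fr, of "W t1"]
    unfolding Y_def Z_def by (metis insertCI vec.scale_right_distrib vec.scale_scale)
  then show False using W1_not_parallel by blast
qed

end

section \<open>Classification of the limit cone\<close>

context invariant_knot
begin

lemma exists_loxodromic:
  obtains A l u a b c where "A \<in> H" "loxodromic_frame A l u a b c"
proof -
  have "W 0 \<noteq> W pi" using W_eq_iff[of 0 pi] by simp
  then obtain A l a where A: "A \<in> H" "a \<noteq> 0" "A *v a = l *s a" "cmod l > 1"
    using exists_expanding[OF W_in_limit_cone[of 0] W_in_limit_cone[of pi]] W_proportional by metis
  then show ?thesis using loxodromic_frame_exists[OF H_U21[OF A(1)] A(2-4)] that by metis
qed

text \<open>
  Some \<open>h\<close> in \<open>H\<close> moves \<open>a\<close> or \<open>b\<close> out of the pair, since the limit set has more than two points. The conjugate by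
  \<open>h\<close> of \<open>A\<close>, or of its inverse, has the moved point as attracting point.
\<close>

lemma exists_loxodromic_elsewhere:
  assumes A: "A \<in> H" and fr: "loxodromic_frame A l u a b c"
  obtains A' l' u' a' b' c' where "A' \<in> H" "loxodromic_frame A' l' u' a' b' c'"
    "herm a' a \<noteq> 0" "herm a' b \<noteq> 0"
proof -
  note d = loxodromic_frameD[OF fr]
  note f = null_frameD[OF d(1)]
  have "\<exists>h\<in>H. \<exists>v\<in>{a, b}. herm (h *v v) a \<noteq> 0 \<and> herm (h *v v) b \<noteq> 0"
  proof (rule ccontr)
    assume not: "\<not> ?thesis"
    have pair: "\<exists>m. h *v v = m *s a \<or> h *v v = m *s b" if "h \<in> H" "v \<in> {a, b}" for h v
    proof -
      have "herm (h *v v) (h *v v) = 0" using that f U21_herm[OF H_U21[OF that(1)]] by auto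
      moreover have "herm (h *v v) a = 0 \<or> herm (h *v v) b = 0" using not that by blast
      ultimately show ?thesis using null_frame_null_cases(1,2)[OF d(1)] by blast
    qed
    obtain q where q: "q \<in> limit_cone" "herm q a \<noteq> 0" "herm q b \<noteq> 0"
      using exists_generic_point[OF A fr] by blast
    obtain m where "q = m *s a \<or> q = m *s b"
      by (rule limit_cone_invariant_pair[OF f(1,2,3) pair pair q(1)]) (simp_all add: that)
    then show False using q f by (auto simp: herm_linear)
  qed
  then obtain h v where h: "h \<in> H" "v \<in> {a, b}" "herm (h *v v) a \<noteq> 0" "herm (h *v v) b \<noteq> 0" by blast
  have "\<exists>B\<in>H. \<exists>l' u' v'. loxodromic_frame B l' u' v v' c"
    using h(2) A fr H_inv[OF A] loxodromic_frame_inverse[OF H_U21[OF A] fr] by blast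
  then obtain B l' u' v' where "B \<in> H" "loxodromic_frame B l' u' v v' c" by blast
  then show ?thesis
    using that[OF H_mult[OF H_mult[OF h(1)] H_inv[OF h(1)]]
        loxodromic_frame_conjugate[OF H_U21[OF h(1)]] h(3,4)] by blast
qed

lemma limit_cone_classification:
  obtains (line) a b c where "null_frame a b c"
      "limit_cone = {z. z \<noteq> 0 \<and> herm z z = 0 \<and> herm z c = 0}"
    | (real_plane) a b c where "null_frame a b c"
      "limit_cone = {m *s (of_real x *s a + of_real y *s b + of_real v *s c) | m x y v.
        m \<noteq> 0 \<and> (x, y, v) \<noteq> (0, 0, 0) \<and> 2 * x * y + v\<^sup>2 = (0::real)}"
proof -
  obtain A l u a b c where A: "A \<in> H" and fr: "loxodromic_frame A l u a b c"
    using exists_loxodromic by blast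
  note d = loxodromic_frameD[OF fr]
  obtain k t0 where k: "k \<noteq> 0" and a: "a = k *s W t0" using attracting_param[OF A fr] .
  show ?thesis
  proof (cases "herm (W1 t0) (W t0) = 0")
    case False
    show ?thesis by (rule line[OF d(1) transverse_limit_cone[OF A fr a False]])
  next
    case True
    obtain w M r where w: "cmod w = 1" and M: "Re M = - 1 / 2" and lu: "l = u\<^sup>2 * cnj l"
      and r: "herm (W1 t0) c = of_real r * w * herm (W t0) b" "r \<noteq> 0"
      and param: "\<And>q. q \<in> limit_cone \<Longrightarrow> herm q b \<noteq> 0 \<Longrightarrow>
        \<exists>x::real. herm q c = of_real x * w * herm q b \<and> herm q a = M * (of_real x)\<^sup>2 * herm q b"
      by (rule tangent_parabola[OF A fr a True]) (rule that)
    show ?thesis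
    proof (cases "Im M = 0")
      case True
      have "M = - 1 / 2" using True M by (simp add: complex_eq_iff)
      have "limit_cone = {m *s (of_real x *s a + of_real y *s b + of_real v *s (w *s c)) | m x y v.
          m \<noteq> 0 \<and> (x, y, v) \<noteq> (0, 0, 0) \<and> 2 * x * y + v\<^sup>2 = (0::real)}"
        using flat_parabola_limit_cone[OF A fr w] param
          parabola_points_in_limit_cone[OF A fr a w lu r param] unfolding \<open>M = - 1 / 2\<close> by simp
      then show ?thesis by (rule real_plane[OF null_frame_rotate[OF d(1) w]])
    next
      case False
      obtain A' l' u' a' b' c' where A': "A' \<in> H" and fr': "loxodromic_frame A' l' u' a' b' c'"
        and a'_ne: "herm a' a \<noteq> 0" "herm a' b \<noteq> 0"
        using exists_loxodromic_elsewhere[OF A fr] by blast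
      obtain k' t1 where a': "k' \<noteq> 0" "a' = k' *s W t1" using attracting_param[OF A' fr'] .
      then have "herm (W t1) a \<noteq> 0" "herm (W t1) b \<noteq> 0" using a'_ne by (simp_all add: herm_linear)
      then have "herm (W1 t1) (W t1) \<noteq> 0"
        by (rule bent_parabola_transverse[OF d(1) w M False, rotated]) (rule param)
      then show ?thesis
        by (rule line[OF loxodromic_frameD(1)[OF fr'] transverse_limit_cone[OF A' fr' a'(2)]])
    qed
  qed
qed

end

section \<open>Projective points and homogeneous coordinates\<close>

lemma in_proj_self: "z \<in> proj z"
  unfolding proj_def by (auto intro!: exI[of _ 1])

lemma proj_eq_iff: "proj z = proj w \<longleftrightarrow> (\<exists>k. k \<noteq> 0 \<and> z = k *s w)"
proof
  assume "proj z = proj w"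
  then show "\<exists>k. k \<noteq> 0 \<and> z = k *s w" using in_proj_self[of z] by (auto simp: proj_def)
next
  assume "\<exists>k. k \<noteq> 0 \<and> z = k *s w"
  then obtain k where k: "k \<noteq> 0" "z = k *s w" by blast
  show "proj z = proj w"
  proof (rule subset_antisym; rule subsetI)
    fix x assume "x \<in> proj z"
    then obtain c where "c \<noteq> 0" "x = (c * k) *s w" by (auto simp: proj_def k)
    then show "x \<in> proj w" using k(1) unfolding proj_def by (auto intro!: exI[of _ "c * k"])
  next
    fix x assume "x \<in> proj w"
    then obtain c where "c \<noteq> 0" "x = c *s w" by (auto simp: proj_def)
    then have "c / k \<noteq> 0" "x = (c / k) *s z" using k by simp_all
    then show "x \<in> proj z" unfolding proj_def by blast
  qed
qed

lemma proj_scale: "k \<noteq> 0 \<Longrightarrow> proj (k *s z) = proj z"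
  using proj_eq_iff by blast

lemma proj_in_HC2_iff: "z \<noteq> 0 \<Longrightarrow> proj z \<in> HC2 \<longleftrightarrow> Re (herm z z) < 0"
proof
  assume "proj z \<in> HC2"
  then obtain w where w: "w \<noteq> 0" "Re (herm w w) < 0" "proj z = proj w" by (auto simp: HC2_def)
  then obtain k where k: "k \<noteq> 0" "z = k *s w" using proj_eq_iff by blast
  have "herm z z = of_real ((cmod k)\<^sup>2) * herm w w"
    using complex_norm_square[of k] by (simp add: k herm_linear)
  then have "Re (herm z z) = (cmod k)\<^sup>2 * Re (herm w w)" by (simp only: Re_complex_of_real Im_complex_of_real times_complex.sel)
  then show "Re (herm z z) < 0" using k w by (simp add: mult_pos_neg)
qed (auto simp: HC2_def)

lemma proj_in_bdHC2_iff: "z \<noteq> 0 \<Longrightarrow> proj z \<in> bdHC2 \<longleftrightarrow> herm z z = 0"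
proof
  assume "proj z \<in> bdHC2"
  then obtain w where w: "w \<noteq> 0" "herm w w = 0" "proj z = proj w" by (auto simp: bdHC2_def)
  then show "herm z z = 0" using proj_eq_iff by (auto simp: herm_linear)
qed (auto simp: bdHC2_def)

lemma openin_P2C_iff:
  "openin P2C_topology U \<longleftrightarrow> U \<subseteq> proj ` (UNIV - {0}) \<and> open {x. x \<noteq> 0 \<and> proj x \<in> U}"
proof -
  have "open (UNIV - {0 :: complex^3})" by (simp add: open_Diff)
  then have "openin (top_of_set (UNIV - {0})) S \<longleftrightarrow> open S" if "S \<subseteq> UNIV - {0 :: complex^3}" for S
    using that by (simp add: openin_open_eq)
  moreover have "{x \<in> UNIV - {0}. proj x \<in> U} = {x. x \<noteq> 0 \<and> proj x \<in> U}" by auto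
  ultimately show ?thesis
    unfolding P2C_topology_def openin_quotient_topology by (simp add: subset_iff)
qed

definition lifts :: "(complex^3^3) set set \<Rightarrow> (complex^3^3) set" where
  "lifts G = {A \<in> U21. pclass A \<in> G}"

text \<open>
  The cone over a ball around \<open>z\<close> is open, so convergence in the quotient topology of the projective
  plane is convergence of suitable representatives. The condition that cluster points be
  approached by other points holds automatically, as the orbit lies in the interior.
\<close>

lemma null_in_limit_set_iff:
  assumes G: "G \<subseteq> PU21" and p: "p \<noteq> 0" "Re (herm p p) < 0" and z: "z \<noteq> 0" "herm z z = 0"
  shows "proj z \<in> limit_set G (proj p) \<longleftrightarrow>
    (\<forall>\<epsilon>>0. \<exists>A\<in>lifts G. \<exists>c. c \<noteq> 0 \<and> dist (c *s (A *v p)) z < \<epsilon>)"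
proof
  assume "proj z \<in> limit_set G (proj p)"
  then have cluster: "\<exists>y. y \<noteq> proj z \<and> y \<in> (\<lambda>g. pact g (proj p)) ` G \<and> y \<in> T"
    if "proj z \<in> T" "openin (subtopology P2C_topology (HC2 \<union> bdHC2)) T" for T
    using that unfolding limit_set_def in_derived_set_of by blast
  show "\<forall>\<epsilon>>0. \<exists>A\<in>lifts G. \<exists>c. c \<noteq> 0 \<and> dist (c *s (A *v p)) z < \<epsilon>"
  proof (intro allI impI)
    fix \<epsilon> :: real assume "\<epsilon> > 0"
    \<comment> \<open>the open cone over the ball of radius \<open>\<epsilon>\<close> around \<open>z\<close>\<close>
    define V where "V = {x. x \<noteq> 0 \<and> (\<exists>c. c \<noteq> 0 \<and> dist (c *s x) z < \<epsilon>)}"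
    have V_scale: "k *s x \<in> V" if "x \<in> V" "k \<noteq> 0" for k x
    proof -
      obtain c where "x \<noteq> 0" "c \<noteq> 0" "dist (c *s x) z < \<epsilon>" using \<open>x \<in> V\<close> V_def by blast
      then show ?thesis using that unfolding V_def by (auto intro!: exI[of _ "c / k"])
    qed
    have "open V"
    proof -
      have "V = (UNIV - {0}) \<inter> (\<Union>c\<in>UNIV - {0}. (\<lambda>x. c *s x) -` ball z \<epsilon>)"
        by (auto simp: V_def dist_commute)
      moreover have "open ((\<lambda>x :: complex^3. c *s x) -` ball z \<epsilon>)" for c
        by (intro open_vimage open_ball)
          (auto simp: continuous_on_def intro!: tendsto_scale tendsto_ident_at)
      ultimately show ?thesis by (auto intro!: open_Int open_Diff open_UN)
    qed
    have pre: "{x. x \<noteq> 0 \<and> proj x \<in> proj ` V} = V"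
    proof -
      have "x \<in> V" if x: "proj x \<in> proj ` V" for x
      proof -
        obtain y where "y \<in> V" "proj x = proj y" using x by blast
        moreover then obtain k where "k \<noteq> 0" "x = k *s y" using proj_eq_iff by blast
        ultimately show ?thesis using V_scale by blast
      qed
      moreover have "x \<noteq> 0" if "x \<in> V" for x using that V_def by blast
      ultimately show ?thesis by blast
    qed
    have "openin P2C_topology (proj ` V)"
      unfolding openin_P2C_iff pre using \<open>open V\<close> V_def by blast
    then have op: "openin (subtopology P2C_topology (HC2 \<union> bdHC2)) (proj ` V \<inter> (HC2 \<union> bdHC2))"
      unfolding openin_subtopology by blast
    have "z \<in> V" using z \<open>\<epsilon> > 0\<close> by (auto simp: V_def intro!: exI[of _ 1])
    then have "proj z \<in> proj ` V \<inter> (HC2 \<union> bdHC2)" using proj_in_bdHC2_iff[OF z(1)] z(2) by blast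
    then obtain g where g: "g \<in> G" "pact g (proj p) \<in> proj ` V" using cluster[OF _ op] by blast
    then obtain A where A: "A \<in> U21" "g = pclass A" using G by (auto simp: PU21_def)
    obtain x where x: "x \<in> V" "proj (A *v p) = proj x"
      using g(2) by (auto simp: A pact_pclass_proj)
    obtain k where "k \<noteq> 0" "A *v p = k *s x" using x(2) proj_eq_iff by blast
    then have "A *v p \<in> V" using V_scale x(1) by simp
    moreover have "A \<in> lifts G" using A g(1) by (simp add: lifts_def)
    ultimately show "\<exists>A\<in>lifts G. \<exists>c. c \<noteq> 0 \<and> dist (c *s (A *v p)) z < \<epsilon>"
      unfolding V_def by blast
  qed
next
  assume near: "\<forall>\<epsilon>>0. \<exists>A\<in>lifts G. \<exists>c. c \<noteq> 0 \<and> dist (c *s (A *v p)) z < \<epsilon>"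
  have bd: "proj z \<in> bdHC2" using proj_in_bdHC2_iff[OF z(1)] z(2) by blast
  have "\<exists>y. y \<noteq> proj z \<and> y \<in> (\<lambda>g. pact g (proj p)) ` G \<and> y \<in> T"
    if T: "proj z \<in> T" "openin (subtopology P2C_topology (HC2 \<union> bdHC2)) T" for T
  proof -
    obtain U where U: "openin P2C_topology U" "T = U \<inter> (HC2 \<union> bdHC2)"
      using T(2) unfolding openin_subtopology by blast
    have "open {x. x \<noteq> 0 \<and> proj x \<in> U}" "z \<in> {x. x \<noteq> 0 \<and> proj x \<in> U}"
      using U T(1) z(1) by (auto simp: openin_P2C_iff)
    then obtain \<epsilon> where \<epsilon>: "\<epsilon> > 0" "\<And>x. dist x z < \<epsilon> \<Longrightarrow> x \<noteq> 0 \<and> proj x \<in> U"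
      unfolding open_dist by blast
    obtain A c where Ac: "A \<in> lifts G" "c \<noteq> 0" "dist (c *s (A *v p)) z < \<epsilon>" using near \<epsilon>(1) by blast
    have A: "A \<in> U21" "pclass A \<in> G" using Ac(1) by (auto simp: lifts_def)
    have y: "proj (c *s (A *v p)) = pact (pclass A) (proj p)"
      by (simp add: pact_pclass_proj proj_scale Ac(2))
    have Ap: "A *v p \<noteq> 0" by (rule U21_vec_nonzero[OF A(1) p(1)])
    have "Re (herm (A *v p) (A *v p)) < 0" using U21_herm[OF A(1)] p(2) by simp
    then have "pact (pclass A) (proj p) \<in> HC2"
      using proj_in_HC2_iff[OF Ap] by (simp add: pact_pclass_proj)
    moreover have "pact (pclass A) (proj p) \<noteq> proj z"
    proof
      assume "pact (pclass A) (proj p) = proj z"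
      then have "proj z \<in> HC2" using \<open>pact (pclass A) (proj p) \<in> HC2\<close> by simp
      then show False using proj_in_HC2_iff[OF z(1)] z(2) by simp
    qed
    moreover have "pact (pclass A) (proj p) \<in> U" using \<epsilon>(2)[OF Ac(3)] y by simp
    ultimately show ?thesis using U(2) A(2) by blast
  qed
  moreover have "proj z \<in> topspace (subtopology P2C_topology (HC2 \<union> bdHC2))"
    using bd z(1) by (simp add: P2C_topology_def)
  ultimately show "proj z \<in> limit_set G (proj p)"
    unfolding limit_set_def in_derived_set_of by blast
qed

lemma lifts_unitary_orbit:
  assumes "discrete_subgroup G" "G \<subseteq> PU21" "Re (herm p p) < 0"
  shows "unitary_orbit (lifts G) p"
proof -
  interpret PGL3: group PGL3 by (rule group_PGL3)
  have sub: "subgroup G PGL3" using assms(1) by (simp add: discrete_subgroup_def)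
  interpret subgroup G PGL3 by (rule sub)
  show ?thesis
  proof
    fix A B assume "A \<in> lifts G" "B \<in> lifts G"
    then show "A ** B \<in> lifts G"
      using m_closed[of "pclass A" "pclass B"]
      by (auto simp: lifts_def U21_mult pclass_mult U21_invertible)
  next
    fix A assume A: "A \<in> lifts G"
    then have inv: "invertible A" "invertible (matrix_inv A)" "matrix_inv A \<in> U21"
      by (auto simp: lifts_def U21_invertible U21_inv)
    have carrier: "pclass B \<in> carrier PGL3" if "invertible B" for B
      using that by (auto simp: PGL3_def FactGroup_def RCOSETS_def pclass_def GL3_def)
    have "pclass (matrix_inv A) \<otimes>\<^bsub>PGL3\<^esub> pclass A = pclass (mat 1)"
      using inv by (simp add: pclass_mult matrix_inv_mult)
    also have "pclass (mat 1) = \<one>\<^bsub>PGL3\<^esub>"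
      by (auto simp: PGL3_def FactGroup_def pclass_eq scalars_def)
    finally have "inv\<^bsub>PGL3\<^esub> (pclass A) = pclass (matrix_inv A)"
      using inv carrier by (intro PGL3.inv_equality) auto
    then show "matrix_inv A \<in> lifts G"
      using m_inv_closed[of "pclass A"] A inv by (auto simp: lifts_def)
  next
    obtain g where "g \<in> G" using one_closed by blast
    then show "lifts G \<noteq> {}" using assms(2) by (auto simp: lifts_def PU21_def)
  qed (use assms(3) in \<open>auto simp: lifts_def\<close>)
qed

text \<open>
  The linear part of the inverse of the affine chart.
\<close>

definition affine_embedding :: "complex \<times> complex \<Rightarrow> complex^3" where
  "affine_embedding w = vector [fst w, snd w, 0]"

lemma bounded_linear_affine_embedding: "bounded_linear affine_embedding"
  unfolding linear_conv_bounded_linear[symmetric]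
  by (rule linearI) (simp_all add: affine_embedding_def vec_eq_iff forall_3)

section \<open>Chains and R-circles in a null frame\<close>

text \<open>
  The orthogonal complement of the positive vector \<open>c\<close> is spanned by \<open>a\<close> and \<open>b\<close> and contains the negative
  vector \<open>a - b\<close>.
\<close>

lemma chain_of_null_frame:
  assumes fr: "null_frame a b c"
  shows "chain (proj ` {z. z \<noteq> 0 \<and> herm z z = 0 \<and> herm z c = 0})"
proof -
  note f = null_frameD[OF fr]
  define S where "S = vec.span {a, b}"
  have S: "z \<in> S \<longleftrightarrow> herm z c = 0" for z
  proof
    assume "z \<in> S"
    then show "herm z c = 0" unfolding S_def
      by (induction rule: vec.span_induct_alt) (auto simp: herm_linear f)
  next
    assume "herm z c = 0"
    then have "z = herm z b *s a + herm z a *s b" using null_frame_expand[OF fr, of z] by simp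
    then show "z \<in> S" unfolding S_def
      by (metis insertCI vec.span_add vec.span_base vec.span_scale)
  qed
  have indep: "vec.independent {a, b}"
  proof -
    have "a \<notin> vec.span {b}"
    proof
      assume "a \<in> vec.span {b}"
      then obtain k where "a = k *s b" by (auto simp: vec.span_singleton)
      then have "herm a b = 0" by (simp add: herm_linear f)
      then show False using f by simp
    qed
    then show ?thesis using f by (simp add: vec.independent_insert)
  qed
  have "a \<noteq> b" using f by auto
  then have "vec.dim S = 2"
    unfolding S_def using vec.dim_eq_card_independent[OF indep] by (simp add: vec.dim_span)
  then have line: "projective_line (proj ` (S - {0}))"
    unfolding projective_line_def S_def using vec.subspace_span by blast
  have "a - b \<in> S" "herm (a - b) (a - b) = - 2" by (simp_all add: S herm_linear f)
  moreover then have "a - b \<noteq> 0" by auto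
  ultimately have "proj (a - b) \<in> proj ` (S - {0}) \<inter> HC2" by (auto simp: HC2_def)
  moreover have "proj ` {z. z \<noteq> 0 \<and> herm z z = 0 \<and> herm z c = 0} = proj ` (S - {0}) \<inter> bdHC2"
    using proj_in_bdHC2_iff by (auto simp: S)
  ultimately show ?thesis unfolding chain_def using line by blast
qed

text \<open>
  The vectors \<open>c\<close>, \<open>(a + b) / sqrt 2\<close> and \<open>(a - b) / sqrt 2\<close> are orthogonal of norms \<open>1\<close>, \<open>1\<close> and \<open>- 1\<close>. The unitary
  matrix with these columns maps real vectors to real combinations of \<open>a\<close>, \<open>b\<close> and \<open>c\<close>.
\<close>

lemma R_circle_of_null_frame:
  assumes fr: "null_frame a b c"
  shows "R_circle (proj ` {m *s (of_real x *s a + of_real y *s b + of_real v *s c) | m x y v.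
        m \<noteq> 0 \<and> (x, y, v) \<noteq> (0, 0, 0) \<and> 2 * x * y + v\<^sup>2 = (0::real)})" (is "R_circle (proj ` ?S)")
proof -
  note f = null_frameD[OF fr]
  define s where "s = complex_of_real (1 / sqrt 2)"
  have s: "s * s = 1 / 2" "cnj s = s"
    by (simp_all add: s_def flip: of_real_mult)
  define M :: "complex^3^3" where
    "M = (\<chi> i j. (vector [c, s *s (a + b), s *s (a - b)] :: complex^3^3)$j$i)"
  have M: "M *v z = z$1 *s c + (s * (z$2 + z$3)) *s a + (s * (z$2 - z$3)) *s b" for z
    by (simp add: M_def vec_eq_iff forall_3 matrix_vector_mult_def sum_3 algebra_simps)
  have herm_M: "herm (M *v z) (M *v w) = herm z w" for z w
  proof -
    have "herm (M *v z) (M *v w) = z$1 * cnj (w$1)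
      + (s * s) * ((z$2 + z$3) * cnj (w$2 - w$3) + (z$2 - z$3) * cnj (w$2 + w$3))"
      unfolding M by (simp add: herm_linear f s(2)) (simp add: algebra_simps)
    also have "\<dots> = herm z w" unfolding s herm_def by (simp add: field_simps)
    finally show ?thesis .
  qed
  have "invertible M"
  proof -
    have "v = 0" if "M *v v = 0" for v
      using herm_M[of _ v] that by (intro herm_nondegenerate) (metis herm_zero(2))
    then show ?thesis
      using invertible_left_inverse matrix_left_invertible_ker by blast
  qed
  then have M_U21: "M \<in> U21" using herm_M by (simp add: U21_def)
  have "proj ` ?S = pact (pclass M) ` (P2R \<inter> bdHC2)"
  proof (rule subset_antisym; rule subsetI)
    fix P assume "P \<in> proj ` ?S"
    then obtain m x y v where P: "P = proj (m *s (of_real x *s a + of_real y *s b + of_real v *s c))"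
      and m: "m \<noteq> 0" and xyv: "(x, y, v) \<noteq> (0, 0, 0)" "2 * x * y + v\<^sup>2 = 0" by blast
    define z :: "complex^3" where
      "z = vector [of_real v, s * of_real (x + y), s * of_real (x - y)]"
    have ss: "s * (s * X + s * Y) = (s * s) * (X + Y)" "s * (s * X - s * Y) = (s * s) * (X - Y)" for X Y
      by (simp_all add: algebra_simps)
    have "s * (s * of_real (x + y) + s * of_real (x - y)) = of_real x"
      "s * (s * of_real (x + y) - s * of_real (x - y)) = of_real y"
      unfolding ss s(1) by simp_all
    then have Mz: "M *v z = of_real x *s a + of_real y *s b + of_real v *s c"
      unfolding M by (simp add: z_def)
    have "herm z z = of_real (2 * x * y + v\<^sup>2)"
      unfolding herm_M[of z z, symmetric] Mz by (simp add: herm_linear f power2_eq_square)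
    then have z0: "herm z z = 0" using xyv(2) by simp
    have "z \<noteq> 0"
    proof
      assume "z = 0"
      then have "of_real x *s a + of_real y *s b + of_real v *s c = 0" using Mz by simp
      then have "herm (of_real x *s a + of_real y *s b + of_real v *s c) e = 0" for e by simp
      from this[of b] this[of a] this[of c] show False using xyv(1) by (simp add: herm_linear f)
    qed
    moreover have "\<forall>i. z$i \<in> \<real>" by (simp add: z_def forall_3 s_def)
    ultimately have "proj z \<in> P2R \<inter> bdHC2" using z0 by (auto simp: P2R_def bdHC2_def)
    moreover have "P = pact (pclass M) (proj z)" by (simp only: P proj_scale[OF m] pact_pclass_proj Mz)
    ultimately show "P \<in> pact (pclass M) ` (P2R \<inter> bdHC2)" by blast
  next
    fix P assume "P \<in> pact (pclass M) ` (P2R \<inter> bdHC2)"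
    then obtain z where z: "z \<noteq> 0" "\<forall>i. z$i \<in> \<real>" "proj z \<in> bdHC2" "P = proj (M *v z)"
      by (auto simp: P2R_def pact_pclass_proj)
    have z0: "herm z z = 0" using z proj_in_bdHC2_iff by blast
    define r where "r i = Re (z$i)" for i
    have r: "z$i = of_real (r i)" for i using z(2) by (simp add: r_def)
    have r0: "(r 1)\<^sup>2 + (r 2)\<^sup>2 = (r 3)\<^sup>2"
    proof -
      have "complex_of_real ((r 1)\<^sup>2 + (r 2)\<^sup>2 - (r 3)\<^sup>2) = 0"
        using z0 by (simp add: herm_def r power2_eq_square)
      then have "(r 1)\<^sup>2 + (r 2)\<^sup>2 - (r 3)\<^sup>2 = 0" by (simp only: of_real_eq_0_iff)
      then show ?thesis by simp
    qed
    define x where "x = (1 / sqrt 2) * (r 2 + r 3)"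
    define y where "y = (1 / sqrt 2) * (r 2 - r 3)"
    have "P = proj (1 *s (of_real x *s a + of_real y *s b + of_real (r 1) *s c))"
      unfolding z(4) M by (simp add: x_def y_def r s_def algebra_simps)
    moreover have "2 * x * y + (r 1)\<^sup>2 = 0"
    proof -
      have "2 * x * y = (r 2 + r 3) * (r 2 - r 3)"
        by (simp add: x_def y_def field_simps)
      then show ?thesis using r0 by (simp add: power2_eq_square algebra_simps)
    qed
    moreover have "(x, y, r 1) \<noteq> (0, 0, 0)"
    proof
      assume "(x, y, r 1) = (0, 0, 0)"
      then have "r 1 = 0" "r 2 = 0" "r 3 = 0" by (auto simp: x_def y_def)
      then show False using z(1) by (simp add: vec_eq_iff forall_3 r)
    qed
    ultimately show "P \<in> proj ` ?S"
      by (intro image_eqI[where x = "1 *s (of_real x *s a + of_real y *s b + of_real (r 1) *s c)"]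
          CollectI exI[of _ 1] exI[of _ x] exI[of _ y] exI[of _ "r 1"]) simp_all
  qed
  then show ?thesis unfolding R_circle_def using M_U21 by (auto simp: PU21_def)
qed

section \<open>The limit set of a discrete group\<close>

theorem theorem1p1:
  fixes G :: "(complex^3^3) set set"
    and p :: "(complex^3) set"
    and \<gamma> :: "complex \<Rightarrow> (complex^3) set"
  assumes "G \<subseteq> PU21" and "discrete_subgroup G"
    and "p \<in> HC2"
    and "regular_knot 2 \<gamma>" and "limit_set G p = \<gamma> ` sphere 0 1"
  shows "chain (limit_set G p) \<or> R_circle (limit_set G p)"
proof -
  note knot = assms(4)[unfolded regular_knot_def]
  obtain p0 where p0: "p0 \<noteq> 0" "Re (herm p0 p0) < 0" "p = proj p0"
    using assms(3) by (auto simp: HC2_def)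
  interpret unitary_orbit "lifts G" p0
    by (rule lifts_unitary_orbit[OF assms(2,1) p0(2)])
  have cone: "z \<in> limit_cone \<longleftrightarrow> z \<noteq> 0 \<and> herm z z = 0 \<and> proj z \<in> limit_set G p" for z
    using null_in_limit_set_iff[OF assms(1) p0(1,2), of z] unfolding limit_cone_def p0(3) by blast
  define f where "f t = affine_chart (\<gamma> (cis t))" for t
  obtain D where D: "D 0 = f" "\<And>i t. i < 2 \<Longrightarrow> (D i has_vector_derivative D (Suc i) t) (at t)"
    using knot unfolding Ck_curve_def f_def by blast
  have D0: "(f has_vector_derivative D 1 t) (at t)" for t using D(2)[of 0 t] D(1) by simp
  have D1: "(D 1 has_vector_derivative D 2 t) (at t)" for t using D(2)[of 1 t] by (simp add: numeral_2_eq_2)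
  define W where "W t = affine_embedding (f t) + axis 3 1" for t
  define W1 where "W1 t = affine_embedding (D 1 t)" for t
  define W2 where "W2 t = affine_embedding (D 2 t)" for t
  have \<gamma>_W: "\<gamma> (cis t) = proj (W t)" for t
  proof -
    have "\<gamma> (cis t) \<in> bdHC2" using knot by auto
    then obtain z where z: "z \<noteq> 0" "herm z z = 0" "\<gamma> (cis t) = proj z" by (auto simp: bdHC2_def)
    then have z3: "z$3 \<noteq> 0" using null_third_nonzero by blast
    have "z = z$3 *s vector [z$1 / z$3, z$2 / z$3, 1]"
      using z3 by (simp add: vec_eq_iff forall_3)
    then have eq: "\<gamma> (cis t) = proj (vector [z$1 / z$3, z$2 / z$3, 1])"
      using z(3) proj_scale[OF z3] by metis
    then have "f t = (z$1 / z$3, z$2 / z$3)" by (simp add: f_def affine_chart_proj)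
    then have "W t = vector [z$1 / z$3, z$2 / z$3, 1]"
      by (simp add: W_def affine_embedding_def vec_eq_iff forall_3 axis_def)
    with eq show ?thesis by simp
  qed
  have W3: "W t $ 3 = 1" for t by (simp add: W_def affine_embedding_def axis_def)
  then have W_ne: "W t \<noteq> 0" for t by (metis zero_index zero_neq_one)
  have circle: "\<exists>t. x = cis t" if "x \<in> sphere 0 1" for x :: complex
    using that complex_norm_eq_1_exp_eq by (metis cis_conv_exp complex_norm_eq_1_exp mem_sphere_0)
  have L: "P \<in> limit_set G p \<longleftrightarrow> (\<exists>t. P = proj (W t))" for P
    unfolding assms(5) using circle by (force simp flip: \<gamma>_W)
  interpret invariant_knot "lifts G" p0 W W1 W2
  proof
    show "(W has_vector_derivative W1 t) (at t)" for t
      unfolding W_def W1_def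
      using bounded_linear.has_vector_derivative[OF bounded_linear_affine_embedding D0]
      by (simp add: has_vector_derivative_add_const)
    show "(W1 has_vector_derivative W2 t) (at t)" for t
      unfolding W1_def W2_def
      by (rule bounded_linear.has_vector_derivative[OF bounded_linear_affine_embedding D1])
    show "W1 t \<noteq> 0" for t
    proof
      assume "W1 t = 0"
      then have "D 1 t = 0"
        by (simp add: W1_def affine_embedding_def vec_eq_iff forall_3 prod_eq_iff)
      then have "vector_derivative f (at t) = 0"
        using D0[of t] vector_derivative_at by metis
      then show False using knot unfolding f_def by blast
    qed
    show "W t $ 3 = 1" for t by (rule W3)
    show "W s = W t \<longleftrightarrow> cis s = cis t" for s t
    proof
      assume "W s = W t"
      then have "\<gamma> (cis s) = \<gamma> (cis t)" by (simp add: \<gamma>_W)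
      moreover have "inj_on \<gamma> (sphere 0 1)" using knot by blast
      ultimately show "cis s = cis t" by (auto dest: inj_onD)
    next
      assume "cis s = cis t"
      then show "W s = W t" by (simp add: W_def f_def)
    qed
    show "z \<in> limit_cone \<longleftrightarrow> (\<exists>k t. k \<noteq> 0 \<and> z = k *s W t)" for z
    proof
      assume "z \<in> limit_cone"
      then show "\<exists>k t. k \<noteq> 0 \<and> z = k *s W t" using cone L proj_eq_iff by metis
    next
      assume "\<exists>k t. k \<noteq> 0 \<and> z = k *s W t"
      then obtain k t where kt: "k \<noteq> 0" "z = k *s W t" by blast
      then have z: "proj z = \<gamma> (cis t)" "z \<noteq> 0" using W_ne by (simp_all add: \<gamma>_W proj_scale)
      then have "proj z \<in> bdHC2" using knot by auto
      then have "herm z z = 0" using proj_in_bdHC2_iff[OF z(2)] by blast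
      moreover have "proj z \<in> limit_set G p" using L z(1) \<gamma>_W by auto
      ultimately show "z \<in> limit_cone" using cone z(2) by blast
    qed
  qed
  have L_cone: "limit_set G p = proj ` limit_cone"
  proof (rule subset_antisym; rule subsetI)
    fix P assume "P \<in> limit_set G p"
    then show "P \<in> proj ` limit_cone" using L W_in_limit_cone by blast
  qed (use cone in blast)
  show ?thesis
  proof (cases rule: limit_cone_classification)
    case (line a b c)
    show ?thesis using chain_of_null_frame[OF line(1)] unfolding L_cone line(2) by (rule disjI1)
  next
    case (real_plane a b c)
    show ?thesis using R_circle_of_null_frame[OF real_plane(1)] unfolding L_cone real_plane(2) by (rule disjI2)
  qed
qed

end
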